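(* Let $k\ge2$ and let $f$ be a nonnegative, nondegenerate real-valued $k$-regular sequence with minimal nondegenerate linear representation $(\mathbf u,\mathcal A,\mathbf v)$. If $\bar\rho(\widehat{\mathcal A})<\rho(\widehat{\mathbf A})/k$, then all continuous ghost measures $\mu_h$ of $f$ are singular with respect to Lebesgue measure.
   Context: Regular sequences. Fix an integer $k\ge2$. For $n\ge1$ let $(n)_k=i_s\cdots i_0$ be the base-$k$ expansion ($i_s\ne0$), and for $d\times d$ matrices $\mathbf A_0,\dots,\mathbf A_{k-1}$ put $\mathbf A_{(n)_k}=\mathbf A_{i_s}\cdots\mathbf A_{i_0}$, with $\mathbf A_{(0)_k}$ the identity. A real sequence $f=(f(n))_{n\ge0}$ is $k$-regular if its $k$-kernel $\{(f(k^\ell n+r))_{n\ge 0}:\ell\ge0,\ 0\le r<k^\ell\}$ spans a finite-dimensional real vector space $V_k(f)$. A linear representation of $f$ of degree $d$ is a tuple $(\mathbf u,\mathcal A,\mathbf v)$ with $\mathbf u,\mathbf v\in\mathbb R^{d}$, $\mathcal A=\{\mathbf A_0,\dots,\mathbf A_{k-1}\}\subset\mathbb R^{d\times d}$ and $f(n)=\mathbf u^T\mathbf A_{(n)_k}\mathbf v$ for all $n\ge 0$; it is minimal if $d=\dim V_k(f)$. Put $\mathbf A=\sum_{j=0}^{k-1}\mathbf A_j$. Ghost measures. For nonnegative $f$ put $\Sigma_f(N)=\sum_{m=k^N}^{k^{N+1}-1}f(m)$ and, when $\Sigma_f(N)\neq0$, $\mu_N=\frac1{\Sigma_f(N)}\sum_{m=0}^{k^{N+1}-k^N-1}f(k^N+m)\,\delta_{m/(k^N(k-1))}$,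 a probability measure on $\mathbb T=[0,1)$ with addition mod $1$. Ghost measures of $f$ are the weak accumulation points of $(\mu_N)_N$; a measure is continuous if it has no atoms. Group and nondegeneracy. Let $V\subset\mathbb R^d$ be the subspace with $V^T=\mathrm{span}\{\mathbf u^T\mathbf A_{(n)_k}:n\ge1\}$, $\mathbf P_V$ the orthogonal projection onto $V$, $\widetilde{\mathbf A}_i=\mathbf P_V\mathbf A_i\mathbf P_V$, $\widetilde{\mathbf A}=\mathbf P_V\mathbf A\mathbf P_V$, $\rho=\rho(\widetilde{\mathbf A})$ the spectral radius, $\{g_1\rho,\dots,g_s\rho\}$ ($|g_i|=1$) the eigenvalues of $\widetilde{\mathbf A}$ of modulus $\rho$, $g=(g_1,\dots,g_s)$ and $G=\overline{\{g^n:n\in\mathbb N\}}$ (closure in the $s$-fold product of the complex unit circle). For $h\in G$ let $\mathbf R_h$ be multiplication by $h_m$ on the generalised eigenspace in $V$ (complexified) of $\widetilde{\mathbf A}$ for $g_m\rho$, and the identity on the other generalised eigenspaces in $V$ and on $V^\perp$; $\mathbf R=\mathbf R_{g^{-1}}$. Let $r$ be the maximal size of a Jordan block of $\widetilde{\mathbf A}$ for an eigenvalue of modulus $\rho$, $c_n=\frac{(r-1)!}{n^{r-1}\rho^{n-r+1}}$, $\mathbf P=\lim_{n\to\infty}c_n\mathbf R^n\widetilde{\mathbf A}^n$ (the limit exists). The representation is nondegenerate if $\rho>0$ and $\mathbf u^T(\mathbf A-\mathbf A_0)\mathbf R_h\mathbf P\mathbf v>0$ for all $h\in G$; $f$ is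 nondegenerate if it has a minimal nondegenerate linear representation. In that case, for each $h\in G$ the measures $\mu_{n_j}$ converge weakly to one and the same measure $\mu_h$ along every sequence $n_j\to\infty$ with $g^{n_j}\to h$, and the ghost measures of $f$ are exactly the $\mu_h$, $h\in G$. Reduced subspace. $\widehat V=\mathrm{span}\{\widetilde{\mathbf A}_0^m\widetilde{\mathbf A}_{(n)_k}\mathbf R_h\mathbf P\mathbf v: m,n\ge0,\ h\in G\}$ (with $\widetilde{\mathbf A}_{(0)_k}$ the identity), $\mathbf P_{\widehat V}$ the orthogonal projection onto $\widehat V$, $\widehat{\mathbf A}_i=\mathbf P_{\widehat V}\widetilde{\mathbf A}_i\mathbf P_{\widehat V}$, $\widehat{\mathcal A}=\{\widehat{\mathbf A}_0,\dots,\widehat{\mathbf A}_{k-1}\}$, $\widehat{\mathbf A}=\sum_i\widehat{\mathbf A}_i$, with spectral radius $\rho(\widehat{\mathbf A})$. The Lyapunov quantity is $\bar\rho(\widehat{\mathcal A})=\lim_{n\to\infty}\big(\prod_{0\le i_1,\dots,i_n\le k-1}\|\widehat{\mathbf A}_{i_1}\cdots\widehat{\mathbf A}_{i_n}\|^{1/n}\big)^{1/k^n}$ (any submultiplicative matrix norm). *)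

theory Defs
  imports
    "HOL-Probability.Probability_Measure"
    "HOL-Library.Function_Algebras"
    "Jordan_Normal_Form.Spectral_Radius"
begin

hide_const (open) Matrix.mat Matrix.vec
no_notation Matrix.vec_index (infixl "$" 100)
no_notation Matrix.scalar_prod (infix "\<bullet>" 70)

section \<open>Regular sequences\<close>

(* The real vector space of all sequences: there is no real_vector instance for functions. *)
global_interpretation seq: vector_space "\<lambda>(c::real) (f::nat \<Rightarrow> real) n. c * f n"
  defines seq_span = seq.span and seq_dim = seq.dim
  by unfold_locales (simp_all add: fun_eq_iff algebra_simps)

definition k_kernel :: "nat \<Rightarrow> (nat \<Rightarrow> real) \<Rightarrow> (nat \<Rightarrow> real) set" where
  "k_kernel k f = {\<lambda>n. f (k ^ l * n + r) | l r. r < k ^ l}"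

definition k_regular :: "nat \<Rightarrow> (nat \<Rightarrow> real) \<Rightarrow> bool" where
  "k_regular k f \<longleftrightarrow> (\<exists>B. finite B \<and> seq_span B = seq_span (k_kernel k f))"

(* Most significant digit first; 0 has the empty expansion. *)
function base_digits :: "nat \<Rightarrow> nat \<Rightarrow> nat list" where
  "base_digits k n = (if k < 2 \<or> n = 0 then [] else base_digits k (n div k) @ [n mod k])"
  by auto
termination by (relation "Wellfounded.measure snd") auto
declare base_digits.simps [simp del]

definition word_prod :: "(nat \<Rightarrow> real ^ 'd ^ 'd) \<Rightarrow> nat list \<Rightarrow> real ^ 'd ^ 'd" where
  "word_prod A w = foldr (\<lambda>i M. A i ** M) w (mat 1)"

definition num_prod :: "nat \<Rightarrow> (nat \<Rightarrow> real ^ 'd ^ 'd) \<Rightarrow> nat \<Rightarrow> real ^ 'd ^ 'd" where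
  "num_prod k A n = word_prod A (base_digits k n)"

(* In a family A only the matrices A 0, ..., A (k - 1) matter. *)
definition linear_representation ::
    "nat \<Rightarrow> (nat \<Rightarrow> real) \<Rightarrow> real ^ 'd \<Rightarrow> (nat \<Rightarrow> real ^ 'd ^ 'd) \<Rightarrow> real ^ 'd \<Rightarrow> bool" where
  "linear_representation k f u A v \<longleftrightarrow> (\<forall>n. f n = u \<bullet> (num_prod k A n *v v))"

definition minimal_representation ::
    "nat \<Rightarrow> (nat \<Rightarrow> real) \<Rightarrow> real ^ 'd \<Rightarrow> (nat \<Rightarrow> real ^ 'd ^ 'd) \<Rightarrow> real ^ 'd \<Rightarrow> bool" where
  "minimal_representation k f u A v \<longleftrightarrow>
     linear_representation k f u A v \<and> CARD('d) = seq_dim (seq_span (k_kernel k f))"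

section \<open>Ghost measures\<close>

definition block_sum :: "nat \<Rightarrow> (nat \<Rightarrow> real) \<Rightarrow> nat \<Rightarrow> real" where
  "block_sum k f N = (\<Sum>m = k ^ N..<k ^ (N + 1). f m)"

(* The circle is represented by the half-open unit interval with its Borel sets. *)
abbreviation circle_borel :: "real measure" where
  "circle_borel \<equiv> restrict_space borel {0..<1}"

abbreviation circle_lebesgue :: "real measure" where
  "circle_lebesgue \<equiv> restrict_space lborel {0..<1}"

definition ghost_approx :: "nat \<Rightarrow> (nat \<Rightarrow> real) \<Rightarrow> nat \<Rightarrow> real measure" where
  "ghost_approx k f N =
     distr (point_measure {0..<k ^ (N + 1) - k ^ N} (\<lambda>m. ennreal (f (k ^ N + m) / block_sum k f N)))
       circle_borel (\<lambda>m. real m / (real k ^ N * (real k - 1)))"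

(* Continuous functions on the circle are the continuous 1-periodic functions on the line. *)
definition circle_weak_conv :: "(nat \<Rightarrow> real measure) \<Rightarrow> real measure \<Rightarrow> bool" where
  "circle_weak_conv M \<mu> \<longleftrightarrow>
     (\<forall>\<phi>::real \<Rightarrow> real. continuous_on UNIV \<phi> \<and> (\<forall>x. \<phi> (x + 1) = \<phi> x) \<longrightarrow>
        (\<lambda>j. integral\<^sup>L (M j) \<phi>) \<longlonglongrightarrow> integral\<^sup>L \<mu> \<phi>)"

(* The weak topology on probability measures on the circle is metrizable, so accumulation
   points are limits of subsequences. *)
definition ghost_measure :: "nat \<Rightarrow> (nat \<Rightarrow> real) \<Rightarrow> real measure \<Rightarrow> bool" where
  "ghost_measure k f \<mu> \<longleftrightarrow>
     sets \<mu> = sets circle_borel \<and> prob_space \<mu> \<and>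
     (\<exists>s. strict_mono s \<and> (\<forall>j. block_sum k f (s j) \<noteq> 0) \<and>
          circle_weak_conv (\<lambda>j. ghost_approx k f (s j)) \<mu>)"

definition continuous_measure :: "'a measure \<Rightarrow> bool" where
  "continuous_measure \<mu> \<longleftrightarrow> (\<forall>x \<in> space \<mu>. emeasure \<mu> {x} = 0)"

definition singular_measures :: "'a measure \<Rightarrow> 'a measure \<Rightarrow> bool" where
  "singular_measures M N \<longleftrightarrow>
     sets M = sets N \<and> (\<exists>S \<in> sets M. emeasure M S = 0 \<and> emeasure N (space N - S) = 0)"

section \<open>Linear algebra\<close>

definition mat_pow :: "real ^ 'd ^ 'd \<Rightarrow> nat \<Rightarrow> real ^ 'd ^ 'd" where
  "mat_pow M n = (((**) M) ^^ n) (mat 1)"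

definition orth_proj :: "(real ^ 'd) set \<Rightarrow> real ^ 'd ^ 'd" where
  "orth_proj W = (THE P. \<forall>x. P *v x \<in> W \<and> x - P *v x \<in> W\<^sup>\<bottom>)"

definition compress :: "(real ^ 'd) set \<Rightarrow> real ^ 'd ^ 'd \<Rightarrow> real ^ 'd ^ 'd" where
  "compress W M = orth_proj W ** M ** orth_proj W"

(* Passage to the matrix type that carries spectra and Jordan normal forms. The enumeration
   of the index type is irrelevant, as another one gives a similar matrix. *)
definition jmat :: "real ^ 'd ^ 'd \<Rightarrow> complex Matrix.mat" where
  "jmat M = Matrix.mat CARD('d) CARD('d)
     (\<lambda>(i, j). complex_of_real (M $ from_nat_into UNIV i $ from_nat_into UNIV j))"

definition spec_rad :: "real ^ 'd ^ 'd \<Rightarrow> real" where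
  "spec_rad M = spectral_radius (jmat M)"

definition peripheral :: "real ^ 'd ^ 'd \<Rightarrow> complex set" where
  "peripheral M = {l \<in> spectrum (jmat M). cmod l = spec_rad M}"

definition max_jordan :: "real ^ 'd ^ 'd \<Rightarrow> nat" where
  "max_jordan M =
     Max {n. \<exists>n_as. jordan_nf (jmat M) n_as \<and> (\<exists>l \<in> peripheral M. (n, l) \<in> set n_as)}"

definition complexification :: "(real ^ 'd) set \<Rightarrow> (complex ^ 'd) set" where
  "complexification W = {x. (\<chi> i. Re (x $ i)) \<in> W \<and> (\<chi> i. Im (x $ i)) \<in> W}"

definition gen_eigenspace ::
    "(real ^ 'd) set \<Rightarrow> real ^ 'd ^ 'd \<Rightarrow> complex \<Rightarrow> (complex ^ 'd) set" where
  "gen_eigenspace W M l =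
     {x \<in> complexification W.
        \<exists>j. ((\<lambda>y. map_matrix complex_of_real M *v y - l *s y) ^^ j) x = 0}"

(* Tuples indexed by the peripheral eigenvalues are functions on the complex numbers that
   are 1 at all other points; the library topology on functions is the product topology. *)
definition phase :: "real ^ 'd ^ 'd \<Rightarrow> complex \<Rightarrow> complex" where
  "phase M l = (if l \<in> peripheral M then l / complex_of_real (spec_rad M) else 1)"

definition phase_group :: "real ^ 'd ^ 'd \<Rightarrow> (complex \<Rightarrow> complex) set" where
  "phase_group M = closure {(\<lambda>l. phase M l ^ n) | n. True}"

(* For h in the phase group the operator is real: conjugate eigenvalues get conjugate factors. *)
definition rot :: "(real ^ 'd) set \<Rightarrow> real ^ 'd ^ 'd \<Rightarrow> (complex \<Rightarrow> complex) \<Rightarrow> real ^ 'd ^ 'd" where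
  "rot W M h = (THE R.
     (\<forall>l \<in> spectrum (jmat M). \<forall>x \<in> gen_eigenspace W M l.
        map_matrix complex_of_real R *v x = (if l \<in> peripheral M then h l else 1) *s x) \<and>
     (\<forall>x \<in> W\<^sup>\<bottom>. R *v x = x))"

definition growth_coeff :: "real ^ 'd ^ 'd \<Rightarrow> nat \<Rightarrow> real" where
  "growth_coeff M n = (let r = max_jordan M in
     fact (r - 1) / (real n ^ (r - 1) * spec_rad M powi (int n - int r + 1)))"

definition limit_op :: "(real ^ 'd) set \<Rightarrow> real ^ 'd ^ 'd \<Rightarrow> real ^ 'd ^ 'd" where
  "limit_op W M =
     lim (\<lambda>n. growth_coeff M n *\<^sub>R
                (mat_pow (rot W M (\<lambda>l. inverse (phase M l))) n ** mat_pow M n))"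

section \<open>Nondegeneracy and the reduced subspace\<close>

definition row_space :: "nat \<Rightarrow> real ^ 'd \<Rightarrow> (nat \<Rightarrow> real ^ 'd ^ 'd) \<Rightarrow> (real ^ 'd) set" where
  "row_space k u A = span {u v* num_prod k A n | n. n \<ge> 1}"

definition tilde :: "nat \<Rightarrow> real ^ 'd \<Rightarrow> (nat \<Rightarrow> real ^ 'd ^ 'd) \<Rightarrow> nat \<Rightarrow> real ^ 'd ^ 'd" where
  "tilde k u A i = compress (row_space k u A) (A i)"

definition tilde_sum :: "nat \<Rightarrow> real ^ 'd \<Rightarrow> (nat \<Rightarrow> real ^ 'd ^ 'd) \<Rightarrow> real ^ 'd ^ 'd" where
  "tilde_sum k u A = compress (row_space k u A) (\<Sum>i<k. A i)"

(* This is R_h P v; the reality of R_h makes it a real vector. *)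
definition limit_vec ::
    "nat \<Rightarrow> real ^ 'd \<Rightarrow> (nat \<Rightarrow> real ^ 'd ^ 'd) \<Rightarrow> real ^ 'd \<Rightarrow> (complex \<Rightarrow> complex) \<Rightarrow> real ^ 'd" where
  "limit_vec k u A v h =
     rot (row_space k u A) (tilde_sum k u A) h *v
       (limit_op (row_space k u A) (tilde_sum k u A) *v v)"

definition nondegenerate_representation ::
    "nat \<Rightarrow> real ^ 'd \<Rightarrow> (nat \<Rightarrow> real ^ 'd ^ 'd) \<Rightarrow> real ^ 'd \<Rightarrow> bool" where
  "nondegenerate_representation k u A v \<longleftrightarrow>
     spec_rad (tilde_sum k u A) > 0 \<and>
     (\<forall>h \<in> phase_group (tilde_sum k u A).
        u \<bullet> (((\<Sum>i<k. A i) - A 0) *v limit_vec k u A v h) > 0)"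

definition reduced_space ::
    "nat \<Rightarrow> real ^ 'd \<Rightarrow> (nat \<Rightarrow> real ^ 'd ^ 'd) \<Rightarrow> real ^ 'd \<Rightarrow> (real ^ 'd) set" where
  "reduced_space k u A v =
     span {mat_pow (tilde k u A 0) m *v (num_prod k (tilde k u A) n *v limit_vec k u A v h) |
             m n h. h \<in> phase_group (tilde_sum k u A)}"

definition hat ::
    "nat \<Rightarrow> real ^ 'd \<Rightarrow> (nat \<Rightarrow> real ^ 'd ^ 'd) \<Rightarrow> real ^ 'd \<Rightarrow> nat \<Rightarrow> real ^ 'd ^ 'd" where
  "hat k u A v i = compress (reduced_space k u A v) (tilde k u A i)"

(* The limit is the same for every submultiplicative norm. Words with zero product give 0 powr _ = 0. *)
definition lyapunov :: "nat \<Rightarrow> (nat \<Rightarrow> real ^ 'd ^ 'd) \<Rightarrow> real" where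
  "lyapunov k B =
     lim (\<lambda>n. (\<Prod>w \<in> {w. set w \<subseteq> {..<k} \<and> length w = n}.
                onorm ((*v) (word_prod B w)) powr (1 / real n)) powr (1 / real (k ^ n)))"

end

theory Submission
  imports Defs
begin

hide_const (open) VectorSpace.subspace

text \<open>
  Cut the circle into cells indexed by a leading digit i and a word w of p further digits. The
  ghost approximants give such a cell the mass u^T A_i A_w A^(N-p) v up to normalisation, and
  u^T A_i lies in the row space, so that all matrices may be replaced by their compressions to
  it. After rescaling, A^(N-p) v accumulates only at multiples of vectors R_h P v, which span the
  reduced subspace; hence a ghost measure without atoms gives the cell a mass of at most
  C rho^(-p) N(w), where N(w) is the norm of the product of the reduced matrices along w.

  The hypothesis makes the geometric mean of N over the words of some length n smaller than
  (rho/k)^n, since rho is at least the spectral radius of the sum of the reduced matrices.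
  Differentiating a moment of N at the exponent 0 gives an s in (0,1) for which the mean of N^s
  is smaller than (rho/k)^(n s), and submultiplicativity turns this into exponential decay along
  the multiples of n. Therefore the sum over the cells I of min(mu(I), |I|), which is at most the
  sum of mu(I)^s |I|^(1-s), is summable over the levels, and the Borel--Cantelli lemma applied to
  the union of the cells with mu(I) at most |I| separates mu from Lebesgue measure.
\<close>

text \<open>The cell bound needs one constant C for all levels p, although removing p digits turns
  the limiting direction from h to h g^(-p), so that each level has its own limit vector. All these
  vectors are bounded together because the entries of h have modulus 1; for this the rotations are
  computed in Jordan coordinates. The operators of the statement are given by descriptions and
  limits, so their existence has to be proved, and since they are found over the complex numbers,
  compatibility with conjugation has to bring them back to real matrices.

  Weak convergence bounds the mass of open arcs from above. A cell is half-open, and the absence of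
  atoms disposes of its left endpoint; this is where continuity of the measure enters.

  The Lyapunov quantity controls an average of logarithms. A moment of small order s converts this
  into geometric decay of sums without any law of large numbers, and the weights s and 1 - s come
  from min(x, y) <= x^s y^(1-s). The levels are multiples of n because the strict inequality is
  known for that one length.\<close>

section \<open>Jordan normal forms in Cartesian coordinates\<close>

text \<open>The inverse of the enumeration of the index type in the definition of jmat.\<close>
definition cidx :: "'d::finite \<Rightarrow> nat" where
  "cidx = to_nat_on UNIV"

lemma bij_cidx: "bij_betw (cidx :: 'd::finite \<Rightarrow> nat) UNIV {..<CARD('d)}"
  unfolding cidx_def by (rule to_nat_on_finite) simp

lemma cidx_less [simp]: "cidx (i :: 'd::finite) < CARD('d)"
  using bij_cidx by (auto simp: bij_betw_def)

lemma cidx_eq_iff [simp]: "cidx (i :: 'd::finite) = cidx j \<longleftrightarrow> i = j"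
  using bij_cidx[where 'd = 'd] by (auto simp: bij_betw_def inj_on_def)

lemma from_nat_into_cidx [simp]: "from_nat_into UNIV (cidx (i :: 'd::finite)) = i"
  unfolding cidx_def by (rule from_nat_into_to_nat_on) auto

lemma sum_cidx: "(\<Sum>i<CARD('d). F i) = (\<Sum>j\<in>(UNIV :: 'd::finite set). F (cidx j))"
  using sum.reindex_bij_betw[OF bij_cidx[where 'd='d], of F] by simp

abbreviation cplx :: "real ^ 'd ^ 'd \<Rightarrow> complex ^ 'd ^ 'd" where
  "cplx M \<equiv> map_matrix complex_of_real M"

definition of_jmat :: "complex Matrix.mat \<Rightarrow> complex ^ 'd ^ 'd" where
  "of_jmat B = (\<chi> i j. B $$ (cidx i, cidx j))"

lemma of_jmat_mult:
  assumes "B \<in> carrier_mat CARD('d) CARD('d)" "C \<in> carrier_mat CARD('d) CARD('d)"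
  shows "(of_jmat (B * C) :: complex ^ 'd::finite ^ 'd) = of_jmat B ** of_jmat C"
  using assms
  by (auto simp: of_jmat_def matrix_matrix_mult_def Finite_Cartesian_Product.vec_eq_iff Matrix.scalar_prod_def sum_cidx
      lessThan_atLeast0[symmetric] intro!: sum.cong)

lemma of_jmat_one: "(of_jmat (1\<^sub>m CARD('d)) :: complex ^ 'd::finite ^ 'd) = Finite_Cartesian_Product.mat 1"
  by (auto simp: of_jmat_def Finite_Cartesian_Product.mat_def Finite_Cartesian_Product.vec_eq_iff)

lemma of_jmat_jmat: "of_jmat (jmat M) = cplx M"
  by (auto simp: of_jmat_def jmat_def Finite_Cartesian_Product.vec_eq_iff map_matrix_def)

lemma jmat_carrier [simp]: "jmat (M :: real ^ 'd ^ 'd) \<in> carrier_mat CARD('d) CARD('d)"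
  by (simp add: jmat_def)

lemma cplx_mult: "cplx (M ** N) = cplx M ** cplx N"
  by (auto simp: Finite_Cartesian_Product.vec_eq_iff map_matrix_def matrix_matrix_mult_def)

lemma cplx_one: "cplx (mat 1) = mat 1"
  by (simp add: Finite_Cartesian_Product.vec_eq_iff map_matrix_def Finite_Cartesian_Product.mat_def)

lemma mat_pow_0 [simp]: "mat_pow M 0 = mat 1"
  by (simp add: mat_pow_def)

lemma mat_pow_Suc: "mat_pow M (Suc n) = M ** mat_pow M n"
  by (simp add: mat_pow_def)

lemma mat_pow_Suc2: "mat_pow M (Suc n) = mat_pow M n ** M"
  by (induction n) (simp_all add: mat_pow_Suc matrix_mul_assoc)

lemma of_jmat_pow: "of_jmat (jmat M ^\<^sub>m n) = cplx (mat_pow M n)"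
proof (induction n)
  case 0
  have "dim_row (jmat M) = CARD('a)" by (simp add: jmat_def)
  then show ?case by (simp add: of_jmat_one cplx_one)
next
  case (Suc n)
  then show ?case
    by (simp add: of_jmat_mult of_jmat_jmat mat_pow_Suc2 cplx_mult pow_carrier_mat[OF jmat_carrier])
qed

text \<open>Growth rates will be read off entry by entry, so the choice between zero and a binomial
  term is made once for all exponents r. For r < m the truncated exponent is harmless, because the
  binomial coefficient vanishes.\<close>

lemma jordan_matrix_pow_entry:
  fixes n_as :: "(nat \<times> complex) list"
  assumes "i < sum_list (map fst n_as)" "j < sum_list (map fst n_as)"
  shows "(\<forall>r. (jordan_matrix n_as ^\<^sub>m r) $$ (i, j) = 0) \<or>
    (\<exists>m s a. (s, a) \<in> set n_as \<and> m < s \<and> j = i + m \<and>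
       jordan_matrix n_as $$ (i, i) = a \<and> jordan_matrix n_as $$ (j, j) = a \<and>
       (\<forall>r. (jordan_matrix n_as ^\<^sub>m r) $$ (i, j) = of_nat (r choose m) * a ^ (r - m)))"
  unfolding jordan_matrix_pow using assms
proof (induction n_as arbitrary: i j)
  case Nil
  then show ?case by simp
next
  case (Cons sa n_as)
  obtain s a where sa: "sa = (s, a)" by force
  let ?B = "\<lambda>r. map (\<lambda>(n, a). jordan_block n a ^\<^sub>m r) n_as"
  let ?D = "\<lambda>r. diag_block_mat (?B r)"
  have dim: "dim_row (?D r) = sum_list (map fst n_as)" "dim_col (?D r) = sum_list (map fst n_as)" for r
    by (induction n_as) (auto simp: Let_def split: prod.splits)
  have dimJ: "dim_row (jordan_matrix n_as) = sum_list (map fst n_as)"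
    "dim_col (jordan_matrix n_as) = sum_list (map fst n_as)" by simp_all
  have J: "jordan_matrix (sa # n_as) =
     four_block_mat (jordan_block s a) (0\<^sub>m s (sum_list (map fst n_as)))
       (0\<^sub>m (sum_list (map fst n_as)) s) (jordan_matrix n_as)"
    using dimJ unfolding jordan_matrix_def sa by (simp add: Let_def)
  have D: "diag_block_mat (map (\<lambda>(n, a). jordan_block n a ^\<^sub>m r) (sa # n_as)) =
     four_block_mat (jordan_block s a ^\<^sub>m r) (0\<^sub>m s (sum_list (map fst n_as)))
       (0\<^sub>m (sum_list (map fst n_as)) s) (?D r)" for r
    by (simp add: sa Let_def dim)
  have lt: "i < s + sum_list (map fst n_as)" "j < s + sum_list (map fst n_as)"
    using Cons.prems by (auto simp: sa)
  consider "i < s" "j < s" "i \<le> j" | "i < s" "j < s" "j < i" | "i < s" "\<not> j < s" | "\<not> i < s" "j < s"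
    | "\<not> i < s" "\<not> j < s" by linarith
  then show ?case
  proof cases
    case 1
    show ?thesis
      unfolding D
      by (rule disjI2, rule exI[of _ "j - i"], rule exI[of _ s], rule exI[of _ a])
        (use 1 lt in \<open>auto simp: J[unfolded sa] sa dim jordan_block_pow\<close>)
  next
    case 2
    then show ?thesis unfolding D using lt by (intro disjI1) (auto simp: jordan_block_pow dim)
  next
    case 3
    then show ?thesis unfolding D using lt by (intro disjI1) (auto simp: dim)
  next
    case 4
    then show ?thesis unfolding D using lt by (intro disjI1) (auto simp: dim)
  next
    case 5
    have lt': "i - s < sum_list (map fst n_as)" "j - s < sum_list (map fst n_as)" using lt 5 by auto
    from Cons.IH[OF lt'] show ?thesis
    proof
      assume "\<forall>r. ?D r $$ (i - s, j - s) = 0"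
      then show ?thesis
        unfolding D using lt 5
        by (intro disjI1 allI) (simp only: index_mat_four_block dim jordan_block_pow_dim, simp)
    next
      assume "\<exists>m s' a. (s', a) \<in> set n_as \<and> m < s' \<and> j - s = i - s + m \<and>
         jordan_matrix n_as $$ (i - s, i - s) = a \<and> jordan_matrix n_as $$ (j - s, j - s) = a \<and>
         (\<forall>r. ?D r $$ (i - s, j - s) = of_nat (r choose m) * a ^ (r - m))"
      then obtain m s' b where *: "(s', b) \<in> set n_as" "m < s'" "j - s = i - s + m"
         "jordan_matrix n_as $$ (i - s, i - s) = b" "jordan_matrix n_as $$ (j - s, j - s) = b"
         "\<forall>r. ?D r $$ (i - s, j - s) = of_nat (r choose m) * b ^ (r - m)" by blast
      have "j = i + m" using *(3) 5 by auto
      moreover have "jordan_matrix (sa # n_as) $$ (i, i) = b" "jordan_matrix (sa # n_as) $$ (j, j) = b"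
        unfolding J using 5 lt * by (simp_all add: dimJ)
      moreover have "diag_block_mat (map (\<lambda>(n, a). jordan_block n a ^\<^sub>m r) (sa # n_as)) $$ (i, j)
          = of_nat (r choose m) * b ^ (r - m)" for r
        unfolding *(6)[rule_format, of r, symmetric] D using 5 lt
        by (subst index_mat_four_block) (simp_all add: dim)
      ultimately show ?thesis using *(1,2) by (intro disjI2 exI[of _ m] exI[of _ s'] exI[of _ b]) simp
    qed
  qed
qed

text \<open>\<open>Max\<close> is meaningful only for a finite set: the block sizes of any Jordan
  form of \<open>M\<close> add up to the dimension, which bounds each of them.\<close>

lemma max_jordan_ge:
  fixes M :: "real ^ 'd ^ 'd"
  assumes "jordan_nf (jmat M) n_as" "(s, l) \<in> set n_as" "l \<in> peripheral M"
  shows "s \<le> max_jordan M"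
proof -
  let ?X = "{n. \<exists>n_as. jordan_nf (jmat M) n_as \<and> (\<exists>l \<in> peripheral M. (n, l) \<in> set n_as)}"
  have "n \<le> CARD('d)" if "n \<in> ?X" for n
  proof -
    from that obtain ns l where ns: "jordan_nf (jmat M) ns" "(n, l) \<in> set ns" by auto
    then have "similar_mat (jmat M) (jordan_matrix ns)" by (simp add: jordan_nf_def)
    then obtain m P Q where "{jmat M, jordan_matrix ns, P, Q} \<subseteq> carrier_mat m m"
      by (blast dest: similar_matD)
    then have "dim_row (jordan_matrix ns) = m" "dim_row (jmat M) = m" by auto
    then have "sum_list (map fst ns) = CARD('d)" by (simp add: jmat_def)
    moreover have "n \<in> set (map fst ns)" using ns(2) by force
    ultimately show ?thesis using member_le_sum_list[of n "map fst ns"] by simp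
  qed
  then have "finite ?X" by (meson finite_nat_set_iff_bounded_le mem_Collect_eq)
  then show ?thesis
    unfolding max_jordan_def by (rule Max_ge) (use assms in blast)
qed

text \<open>\<open>J n\<close> is the n-th power of one Jordan matrix, written in Cartesian
  coordinates; keeping all powers at once makes their binomial entries available. The offset m is
  bounded for peripheral eigenvalues, where it governs the polynomial growth; the other entries will
  decay geometrically after rescaling.\<close>

definition jordan_data ::
    "real ^ 'd ^ 'd \<Rightarrow> complex ^ 'd ^ 'd \<Rightarrow> complex ^ 'd ^ 'd \<Rightarrow> (nat \<Rightarrow> complex ^ 'd ^ 'd) \<Rightarrow> ('d \<Rightarrow> complex) \<Rightarrow> bool" where
  "jordan_data M S T J lam \<longleftrightarrow>
     S ** T = mat 1 \<and> T ** S = mat 1 \<and>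
     (\<forall>n. cplx (mat_pow M n) = S ** J n ** T) \<and>
     (\<forall>n i. J n $ i $ i = lam i ^ n) \<and>
     spectrum (jmat M) = range lam \<and>
     (\<forall>i j. (\<forall>n. J n $ i $ j = 0) \<or>
       (\<exists>m. lam i = lam j \<and> cidx j = cidx i + m \<and> (lam i \<in> peripheral M \<longrightarrow> m < max_jordan M) \<and>
          (\<forall>n. J n $ i $ j = of_nat (n choose m) * lam i ^ (n - m))))"

lemma ex_jordan_data: "\<exists>S T J lam. jordan_data (M :: real ^ 'd ^ 'd) S T J lam"
proof -
  let ?N = "CARD('d)"
  obtain as where "char_poly (jmat M) = (\<Prod>a\<leftarrow>as. [:- a, 1:])"
    using char_poly_factorized[OF jmat_carrier, of M] by blast
  then obtain ns where ns: "jordan_nf (jmat M) ns"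
    using jordan_nf_exists[OF jmat_carrier] by blast
  then have sim: "similar_mat (jmat M) (jordan_matrix ns)" by (simp add: jordan_nf_def)
  then obtain P Q where "similar_mat_wit (jmat M) (jordan_matrix ns) P Q"
    unfolding similar_mat_def by blast
  note wit = similar_mat_witD2[OF jmat_carrier this]
  note pw = similar_mat_wit_pow_id[OF \<open>similar_mat_wit (jmat M) (jordan_matrix ns) P Q\<close>]
  let ?J = "jordan_matrix ns"
  have dimJ: "sum_list (map fst ns) = ?N" using wit(5) by auto
  define lam where "lam = (\<lambda>i::'d. ?J $$ (cidx i, cidx i))"
  define J where "J = (\<lambda>n. of_jmat (?J ^\<^sub>m n) :: complex ^ 'd ^ 'd)"
  have Jc: "?J ^\<^sub>m n \<in> carrier_mat ?N ?N" for n using wit(5) by simp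
  have entry: "(\<forall>n. J n $ i $ j = 0) \<or>
       (\<exists>m. lam i = lam j \<and> cidx j = cidx i + m \<and> (lam i \<in> peripheral M \<longrightarrow> m < max_jordan M) \<and>
          (\<forall>n. J n $ i $ j = of_nat (n choose m) * lam i ^ (n - m)))" for i j
    using jordan_matrix_pow_entry[of "cidx i" ns "cidx j"] max_jordan_ge[OF ns]
    unfolding dimJ by (fastforce simp: J_def lam_def of_jmat_def)
  have diag: "J n $ i $ i = lam i ^ n" for n i
  proof -
    \<comment> \<open>The power 0 rules out that the entry vanishes for all exponents, and on the
      diagonal the offset m can only be 0.\<close>
    have "J 0 = mat 1" using dimJ by (simp add: J_def of_jmat_one)
    then have "J 0 $ i $ i \<noteq> 0" by (simp add: Finite_Cartesian_Product.mat_def)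
    with entry[of i i] show ?thesis by auto
  qed
  have spec: "spectrum (jmat M) = range lam"
  proof -
    have "spectrum (jmat M) = {k. poly (char_poly ?J) k = 0}"
      using spectrum_root_char_poly[OF jmat_carrier, of M] char_poly_similar[OF sim] by simp
    also have "char_poly ?J = (\<Prod>a\<leftarrow>diag_mat ?J. [:- a, 1:])"
      by (rule char_poly_upper_triangular[OF wit(5)]) (auto simp: jordan_matrix_upper_triangular)
    also have "{k. poly (\<Prod>a\<leftarrow>diag_mat ?J. [:- a, 1:]) k = 0} = set (diag_mat ?J)"
      by (auto simp: poly_prod_list prod_list_zero_iff)
    also have "\<dots> = (\<lambda>i. ?J $$ (i, i)) ` {..<?N}"
      using wit(5) by (auto simp: diag_mat_def)
    also have "{..<?N} = cidx ` (UNIV :: 'd set)"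
      using bij_cidx[where 'd = 'd] by (auto simp: bij_betw_def)
    finally show ?thesis by (simp add: lam_def image_image)
  qed
  have pow: "cplx (mat_pow M n) = of_jmat P ** J n ** of_jmat Q" for n
    unfolding of_jmat_pow[symmetric] pw J_def
    using wit Jc[of n] by (simp add: of_jmat_mult[symmetric] mult_carrier_mat[of _ ?N ?N])
  have "jordan_data M (of_jmat P) (of_jmat Q) J lam"
    unfolding jordan_data_def
    using entry diag spec pow wit(1,2,6,7) by (simp add: of_jmat_mult[symmetric] of_jmat_one)
  then show ?thesis by blast
qed

section \<open>Complexification and conjugation\<close>

abbreviation cvec :: "real ^ 'd \<Rightarrow> complex ^ 'd" where
  "cvec x \<equiv> (\<chi> i. complex_of_real (x $ i))"

lemma cplx_mult_vec: "cplx M *v cvec x = cvec (M *v x)"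
  by (simp add: Finite_Cartesian_Product.vec_eq_iff map_matrix_def matrix_vector_mult_def)

lemma cvec_eq_iff: "cvec x = cvec y \<longleftrightarrow> x = y"
  by (simp add: Finite_Cartesian_Product.vec_eq_iff)

definition cnj_vec :: "complex ^ 'd \<Rightarrow> complex ^ 'd" where
  "cnj_vec x = (\<chi> i. cnj (x $ i))"

lemma cnj_vec_cnj_vec [simp]: "cnj_vec (cnj_vec x) = x"
  by (simp add: cnj_vec_def Finite_Cartesian_Product.vec_eq_iff)

lemma cnj_vec_mult: "cnj_vec (A *v x) = map_matrix cnj A *v cnj_vec x"
  by (simp add: cnj_vec_def Finite_Cartesian_Product.vec_eq_iff map_matrix_def matrix_vector_mult_def)

lemma cnj_vec_simps: "cnj_vec (x - y) = cnj_vec x - cnj_vec y" "cnj_vec (c *s x) = cnj c *s cnj_vec x"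
  "cnj_vec 0 = 0"
  by (simp_all add: cnj_vec_def Finite_Cartesian_Product.vec_eq_iff)

lemma map_matrix_cnj_cplx: "map_matrix cnj (cplx M) = cplx M"
  by (simp add: Finite_Cartesian_Product.vec_eq_iff map_matrix_def)

text \<open>Rotations and the limit operator are constructed over the complex numbers; this brings
  them back to the real matrices of the definitions.\<close>

lemma cnj_eq_imp_cplx:
  assumes "map_matrix cnj E = E"
  shows "\<exists>R. cplx R = E"
proof
  show "cplx (map_matrix Re E) = E"
    using assms by (simp add: Finite_Cartesian_Product.vec_eq_iff map_matrix_def complex_eq_iff)
qed

lemma mult_axis: "(A :: complex ^ 'd ^ 'd) *v axis i 1 = column i A"
  by (simp add: Finite_Cartesian_Product.vec_eq_iff matrix_vector_mult_def column_def axis_def if_distrib cong: if_cong)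

lemma matrix_eq_columns:
  "(\<And>i. (A :: complex ^ 'd ^ 'd) *v axis i 1 = B *v axis i 1) \<Longrightarrow> A = B"
  by (simp add: mult_axis Finite_Cartesian_Product.vec_eq_iff column_def)

definition diag_mtx :: "('d \<Rightarrow> complex) \<Rightarrow> complex ^ 'd ^ 'd" where
  "diag_mtx d = (\<chi> i j. if i = j then d i else 0)"

lemma diag_mtx_mult_vec: "diag_mtx d *v x = (\<chi> i. d i * x $ i)"
  by (simp add: diag_mtx_def Finite_Cartesian_Product.vec_eq_iff matrix_vector_mult_def if_distrib[where f = "\<lambda>x. x * _"] cong: if_cong)

lemma diag_mtx_mult: "diag_mtx d ** A = (\<chi> i j. d i * A $ i $ j)"
  by (simp add: diag_mtx_def Finite_Cartesian_Product.vec_eq_iff matrix_matrix_mult_def if_distrib[where f = "\<lambda>x. x * _"] cong: if_cong)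

lemma complexification_lincomb:
  assumes "subspace W" "x \<in> complexification W" "y \<in> complexification W"
  shows "x + y \<in> complexification W" "x - y \<in> complexification W" "c *s x \<in> complexification W"
proof -
  have [simp]: "(\<chi> i. Re ((x + y) $ i)) = (\<chi> i. Re (x $ i)) + (\<chi> i. Re (y $ i))"
    "(\<chi> i. Im ((x + y) $ i)) = (\<chi> i. Im (x $ i)) + (\<chi> i. Im (y $ i))"
    "(\<chi> i. Re ((x - y) $ i)) = (\<chi> i. Re (x $ i)) - (\<chi> i. Re (y $ i))"
    "(\<chi> i. Im ((x - y) $ i)) = (\<chi> i. Im (x $ i)) - (\<chi> i. Im (y $ i))"
    "(\<chi> i. Re ((c *s x) $ i)) = Re c *\<^sub>R (\<chi> i. Re (x $ i)) - Im c *\<^sub>R (\<chi> i. Im (x $ i))"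
    "(\<chi> i. Im ((c *s x) $ i)) = Re c *\<^sub>R (\<chi> i. Im (x $ i)) + Im c *\<^sub>R (\<chi> i. Re (x $ i))"
    by (simp_all add: Finite_Cartesian_Product.vec_eq_iff)
  show "x + y \<in> complexification W" "x - y \<in> complexification W" "c *s x \<in> complexification W"
    using assms unfolding complexification_def mem_Collect_eq
    by (auto intro!: subspace_add subspace_diff subspace_scale simp del: vector_add_component
        vector_minus_component vector_smult_component)
qed

lemma complexification_0: "subspace W \<Longrightarrow> 0 \<in> complexification W"
  by (simp add: complexification_def Finite_Cartesian_Product.zero_vec_def[symmetric] subspace_0)

lemma complexification_sum:
  assumes "subspace W" "finite I" "\<And>i. i \<in> I \<Longrightarrow> x i \<in> complexification W"
  shows "(\<Sum>i\<in>I. x i) \<in> complexification W"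
  using assms(2,3)
  by (induction I rule: finite_induct)
    (auto simp: complexification_0[OF assms(1)] complexification_lincomb(1)[OF assms(1)])

lemma cvec_in_complexification: "subspace W \<Longrightarrow> x \<in> W \<Longrightarrow> cvec x \<in> complexification W"
  by (simp add: complexification_def Finite_Cartesian_Product.zero_vec_def[symmetric] subspace_0)

lemma cplx_mult_in_complexification:
  assumes "\<And>x. M *v x \<in> W"
  shows "cplx M *v y \<in> complexification W"
proof -
  have "(\<chi> i. Re ((cplx M *v y) $ i)) = M *v (\<chi> i. Re (y $ i))"
    "(\<chi> i. Im ((cplx M *v y) $ i)) = M *v (\<chi> i. Im (y $ i))"
    by (simp_all add: Finite_Cartesian_Product.vec_eq_iff map_matrix_def matrix_vector_mult_def)
  then show ?thesis using assms by (simp add: complexification_def)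
qed

section \<open>Generalised eigenspaces in Jordan coordinates\<close>

locale jordan_setting =
  fixes M :: "real ^ 'd ^ 'd" and S T :: "complex ^ 'd ^ 'd" and J lam
  assumes jordan: "jordan_data M S T J lam"
begin

lemma ST: "S ** T = mat 1" and TS: "T ** S = mat 1"
  and pow: "cplx (mat_pow M n) = S ** J n ** T" and diag: "J n $ i $ i = lam i ^ n"
  and spec: "spectrum (jmat M) = range lam"
  using jordan[unfolded jordan_data_def] by simp_all

lemma entry: "(\<forall>n. J n $ i $ j = 0) \<or>
       (\<exists>m. lam i = lam j \<and> cidx j = cidx i + m \<and> (lam i \<in> peripheral M \<longrightarrow> m < max_jordan M) \<and>
          (\<forall>n. J n $ i $ j = of_nat (n choose m) * lam i ^ (n - m)))"
  using jordan[unfolded jordan_data_def] by (elim conjE) (erule allE)+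

lemma ST_vec [simp]: "S *v (T *v x) = x" and TS_vec [simp]: "T *v (S *v x) = x"
  by (simp_all add: matrix_vector_mul_assoc ST TS)

definition shifted_jordan :: "complex \<Rightarrow> complex ^ 'd \<Rightarrow> complex ^ 'd" where
  "shifted_jordan l z = J 1 *v z - l *s z"

text \<open>The generalised eigenspace for l in the whole complexified space, as a condition on
  Jordan coordinates; \<open>gen_iff\<close> identifies it with the usual description.\<close>

definition gen :: "complex \<Rightarrow> (complex ^ 'd) set" where
  "gen l = {x. \<forall>i. lam i \<noteq> l \<longrightarrow> (T *v x) $ i = 0}"

abbreviation shifted :: "complex \<Rightarrow> complex ^ 'd \<Rightarrow> complex ^ 'd" where
  "shifted l \<equiv> \<lambda>y. cplx M *v y - l *s y"

lemma cplx_M: "cplx M = S ** J 1 ** T"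
  using pow[of 1] by (simp add: mat_pow_Suc)

lemma T_shifted_pow: "T *v ((shifted l ^^ j) x) = (shifted_jordan l ^^ j) (T *v x)"
proof (induction j)
  case (Suc j)
  have "T *v (shifted l y) = shifted_jordan l (T *v y)" for y
    by (simp add: shifted_jordan_def matrix_vector_mult_diff_distrib vector_scalar_commute cplx_M
        matrix_vector_mul_assoc[symmetric])
  then show ?case using Suc by simp
qed simp

text \<open>\<open>J 1\<close> is upper triangular in the order given by \<open>cidx\<close> and
  couples only coordinates with equal eigenvalues.\<close>

lemma shifted_jordan_component:
  "shifted_jordan l z $ i = (lam i - l) * z $ i + (\<Sum>j\<in>{j. cidx i < cidx j \<and> lam j = lam i}. J 1 $ i $ j * z $ j)"
proof -
  have "(J 1 *v z) $ i = J 1 $ i $ i * z $ i + (\<Sum>j\<in>UNIV - {i}. J 1 $ i $ j * z $ j)"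
    by (simp add: matrix_vector_mult_def sum.remove[of UNIV i])
  also have "(\<Sum>j\<in>UNIV - {i}. J 1 $ i $ j * z $ j) =
     (\<Sum>j\<in>{j. cidx i < cidx j \<and> lam j = lam i}. J 1 $ i $ j * z $ j)"
  proof (rule sum.mono_neutral_right)
    show "\<forall>j\<in>UNIV - {i} - {j. cidx i < cidx j \<and> lam j = lam i}. J 1 $ i $ j * z $ j = 0"
    proof
      fix j assume j: "j \<in> UNIV - {i} - {j. cidx i < cidx j \<and> lam j = lam i}"
      have "J 1 $ i $ j = 0"
        using entry[of i j]
      proof
        assume "\<exists>m. lam i = lam j \<and> cidx j = cidx i + m \<and> (lam i \<in> peripheral M \<longrightarrow> m < max_jordan M) \<and>
          (\<forall>n. J n $ i $ j = of_nat (n choose m) * lam i ^ (n - m))"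
        then obtain m where m: "lam i = lam j" "cidx j = cidx i + m" by blast
        with j have "m = 0" by auto
        with m have "i = j" by simp
        with j show ?thesis by simp
      qed simp
      then show "J 1 $ i $ j * z $ j = 0" by simp
    qed
  qed auto
  finally show ?thesis using diag[of 1 i] by (simp add: shifted_jordan_def algebra_simps)
qed

text \<open>Take the last coordinate with eigenvalue different from l at which z is nonzero. The
  terms coupled to it vanish, which leaves the nonzero factor \<open>lam i - l\<close>.\<close>

lemma shifted_jordan_nonzero:
  assumes "lam i \<noteq> l" "z $ i \<noteq> 0"
  shows "\<exists>i. lam i \<noteq> l \<and> shifted_jordan l z $ i \<noteq> 0"
proof -
  let ?X = "{i. lam i \<noteq> l \<and> z $ i \<noteq> 0}"
  obtain i where i: "i \<in> ?X" "\<And>j. j \<in> ?X \<Longrightarrow> cidx j \<le> cidx i"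
  proof -
    have "?X \<noteq> {}" using assms by auto
    then have "Max (cidx ` ?X) \<in> cidx ` ?X" by (intro Max_in) auto
    then obtain i where "i \<in> ?X" "cidx i = Max (cidx ` ?X)" by (metis (no_types, lifting) imageE)
    then show thesis using that by simp
  qed
  have "shifted_jordan l z $ i = (lam i - l) * z $ i"
    unfolding shifted_jordan_component using i by (auto intro!: sum.neutral) (metis linorder_not_less)
  then show ?thesis using i by auto
qed

text \<open>On coordinates with eigenvalue l the diagonal term vanishes, so each application moves
  the end of the support back by at least one; \<open>CARD('d)\<close> applications leave
  nothing.\<close>

lemma shifted_jordan_support:
  assumes "\<And>i. z $ i \<noteq> 0 \<Longrightarrow> lam i = l \<and> cidx i + k < CARD('d)" "shifted_jordan l z $ i \<noteq> 0"
  shows "lam i = l \<and> cidx i + Suc k < CARD('d)"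
proof -
  have "(lam i - l) * z $ i = 0" using assms(1)[of i] by auto
  then obtain j where "cidx i < cidx j" "lam j = lam i" "z $ j \<noteq> 0"
    using assms(2) unfolding shifted_jordan_component by (auto elim!: sum.not_neutral_contains_not_neutral)
  then show ?thesis using assms(1)[of j] by auto
qed

lemma gen_iff: "(\<exists>j. (shifted l ^^ j) x = 0) \<longleftrightarrow> x \<in> gen l"
proof
  assume "\<exists>j. (shifted l ^^ j) x = 0"
  then obtain j where j: "(shifted_jordan l ^^ j) (T *v x) = 0"
    by (metis T_shifted_pow matrix_vector_mult_0_right)
  have *: "\<exists>i. lam i \<noteq> l \<and> (shifted_jordan l ^^ j) z $ i \<noteq> 0" if "lam i \<noteq> l" "z $ i \<noteq> 0" for j i z
  proof (induction j)
    case 0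
    then show ?case using that by auto
  next
    case (Suc j)
    then show ?case using shifted_jordan_nonzero by fastforce
  qed
  show "x \<in> gen l"
    using *[of _ "T *v x" j] j by (auto simp: gen_def)
next
  assume x: "x \<in> gen l"
  have "(shifted_jordan l ^^ k) (T *v x) $ i \<noteq> 0 \<Longrightarrow> lam i = l \<and> cidx i + k < CARD('d)" for k i
  proof (induction k arbitrary: i)
    case 0
    then show ?case using x by (auto simp: gen_def)
  next
    case (Suc k)
    then show ?case using shifted_jordan_support[of "(shifted_jordan l ^^ k) (T *v x)" l k i] by auto
  qed
  from this[where k = "CARD('d)"] have "(shifted_jordan l ^^ CARD('d)) (T *v x) = 0"
    by (auto simp: Finite_Cartesian_Product.vec_eq_iff)
  then have "T *v ((shifted l ^^ CARD('d)) x) = 0" by (simp add: T_shifted_pow)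
  then show "\<exists>j. (shifted l ^^ j) x = 0" by (metis ST_vec matrix_vector_mult_0_right)
qed

lemma S_axis_in_gen: "S *v axis i 1 \<in> gen (lam i)"
  by (auto simp: gen_def axis_def)

lemma cnj_gen: "x \<in> gen l \<Longrightarrow> cnj_vec x \<in> gen (cnj l)"
proof -
  assume "x \<in> gen l"
  then obtain j where "(shifted l ^^ j) x = 0" using gen_iff by blast
  moreover have "cnj_vec ((shifted l ^^ j) x) = (shifted (cnj l) ^^ j) (cnj_vec x)" for j
    by (induction j) (simp_all add: cnj_vec_simps cnj_vec_mult map_matrix_cnj_cplx)
  ultimately have "(shifted (cnj l) ^^ j) (cnj_vec x) = 0" by (metis cnj_vec_simps(3))
  then show ?thesis using gen_iff by blast
qed

text \<open>Membership in the spectrum in a form that can be conjugated, and carried over from one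
  matrix to another with a different Jordan basis.\<close>

lemma range_lam_iff: "l \<in> range lam \<longleftrightarrow> (\<exists>x\<in>gen l. x \<noteq> 0)"
proof
  assume "l \<in> range lam"
  then obtain i where "l = lam i" by auto
  moreover have "S *v axis i 1 \<noteq> 0"
    by (metis TS_vec axis_eq_0_iff matrix_vector_mult_0_right zero_neq_one)
  ultimately show "\<exists>x\<in>gen l. x \<noteq> 0" using S_axis_in_gen by blast
next
  assume "\<exists>x\<in>gen l. x \<noteq> 0"
  then obtain x where x: "x \<in> gen l" "x \<noteq> 0" by blast
  then have "T *v x \<noteq> 0" by (metis ST_vec matrix_vector_mult_0_right)
  then show "l \<in> range lam" using x(1) by (auto simp: gen_def Finite_Cartesian_Product.vec_eq_iff)
qed

lemma cnj_peripheral: "cnj l \<in> peripheral M \<longleftrightarrow> l \<in> peripheral M"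
proof -
  have "cnj l \<in> range lam" if "l \<in> range lam" for l
    using that cnj_gen unfolding range_lam_iff by (metis cnj_vec_cnj_vec cnj_vec_simps(3))
  then show ?thesis unfolding peripheral_def spec by (metis (no_types, lifting) complex_cnj_cnj complex_mod_cnj mem_Collect_eq)
qed

text \<open>The operator that multiplies the generalised eigenspace of each eigenvalue l by
  \<open>c l\<close>. The rotations R_h are of this form.\<close>

definition conj_diag :: "(complex \<Rightarrow> complex) \<Rightarrow> complex ^ 'd ^ 'd" where
  "conj_diag c = S ** diag_mtx (\<lambda>i. c (lam i)) ** T"

lemma conj_diag_gen:
  assumes "x \<in> gen l"
  shows "conj_diag c *v x = c l *s x"
proof -
  have "diag_mtx (\<lambda>i. c (lam i)) *v (T *v x) = c l *s (T *v x)"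
    using assms by (auto simp: diag_mtx_mult_vec Finite_Cartesian_Product.vec_eq_iff gen_def)
  then have "conj_diag c *v x = S *v (c l *s (T *v x))"
    by (simp add: conj_diag_def matrix_vector_mul_assoc[symmetric])
  then show ?thesis by (simp add: vector_scalar_commute)
qed

text \<open>Conjugation carries the generalised eigenspace of l to that of \<open>cnj l\<close>, so
  the operator and its conjugate agree on the Jordan basis \<open>S *v axis i 1\<close>.\<close>

lemma conj_diag_real:
  assumes "\<And>l. c (cnj l) = cnj (c l)"
  shows "\<exists>R. cplx R = conj_diag c"
proof (rule cnj_eq_imp_cplx)
  let ?E = "conj_diag c"
  have "(map_matrix cnj ?E ** S) *v axis i 1 = (?E ** S) *v axis i 1" for i
  proof -
    let ?b = "S *v axis i 1"
    have "map_matrix cnj ?E *v ?b = cnj_vec (?E *v cnj_vec ?b)"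
      by (simp only: cnj_vec_mult[of ?E] cnj_vec_cnj_vec)
    also have "\<dots> = cnj_vec (c (cnj (lam i)) *s cnj_vec ?b)"
      by (simp add: conj_diag_gen[OF cnj_gen[OF S_axis_in_gen]])
    also have "\<dots> = ?E *v ?b"
      by (simp add: assms cnj_vec_simps conj_diag_gen[OF S_axis_in_gen])
    finally show ?thesis by (simp add: matrix_vector_mul_assoc[symmetric])
  qed
  then have "map_matrix cnj ?E ** S = ?E ** S" by (rule matrix_eq_columns)
  then have "map_matrix cnj ?E ** (S ** T) = ?E ** (S ** T)" by (simp add: matrix_mul_assoc)
  then show "map_matrix cnj ?E = ?E" by (simp add: ST)
qed

end

section \<open>The rotation operators\<close>

lemma matrix_vector_mult_sum_right:
  "(A :: complex ^ 'd ^ 'd) *v (\<Sum>i\<in>I. x i) = (\<Sum>i\<in>I. A *v x i)"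
  by (induction I rule: infinite_finite_induct) (simp_all add: matrix_vector_right_distrib)

lemma subspace_perp_decomposition:
  fixes W :: "'a :: euclidean_space set"
  assumes "subspace W"
  shows "\<exists>a b. a \<in> W \<and> b \<in> W\<^sup>\<bottom> \<and> x = a + b"
proof -
  obtain a b where "a \<in> span W" "\<And>w. w \<in> span W \<Longrightarrow> b \<bullet> w = 0" "x = a + b"
    by (rule orthogonal_subspace_decomp_exists[of W x, unfolded Linear_Algebra.orthogonal_def]) blast
  moreover have "span W = W" using assms by (rule span_eq_iff[THEN iffD2])
  ultimately have "a \<in> W \<and> b \<in> W\<^sup>\<bottom> \<and> x = a + b"
    by (auto simp: orthogonal_comp_def Linear_Algebra.orthogonal_def inner_commute)
  then show ?thesis by blast
qed

text \<open>The conditions on \<open>W\<close> are those that a compression to \<open>W\<close>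
  satisfies. A positive spectral radius keeps 0, the eigenvalue on the orthogonal complement of
  \<open>W\<close>, out of the peripheral spectrum.\<close>

locale rotation_setting = jordan_setting M S T J lam
  for M :: "real ^ 'd ^ 'd" and S T :: "complex ^ 'd ^ 'd" and J lam +
  fixes W :: "(real ^ 'd) set"
  assumes W: "subspace W" and range: "\<And>x. M *v x \<in> W" and kernel: "\<And>x. x \<in> W\<^sup>\<bottom> \<Longrightarrow> M *v x = 0"
    and spec_pos: "spec_rad M > 0"
begin

lemma zero_not_peripheral: "0 \<notin> peripheral M"
  using spec_pos by (auto simp: peripheral_def)

text \<open>By induction on the nilpotency index: l x is the difference of M x, which lies in the
  range of M, and (M - l) x, which has smaller index.\<close>

lemma gen_nonzero_in_complexification:
  assumes "x \<in> gen l" "l \<noteq> 0"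
  shows "x \<in> complexification W"
proof -
  obtain j where "(shifted l ^^ j) x = 0" using assms(1) gen_iff by blast
  then show ?thesis
  proof (induction j arbitrary: x)
    case 0
    then show ?case by (simp add: complexification_0[OF W])
  next
    case (Suc j)
    have "shifted l x \<in> complexification W"
      using Suc.prems by (intro Suc.IH) (simp only: funpow_Suc_right comp_apply)
    then have "cplx M *v x - shifted l x \<in> complexification W"
      by (rule complexification_lincomb(2)[OF W cplx_mult_in_complexification[OF range]])
    then have "l *s x \<in> complexification W" by simp
    then have "(1 / l) *s (l *s x) \<in> complexification W"
      by (rule complexification_lincomb(3)[OF W _ complexification_0[OF W]])
    moreover have "(1 / l) *s (l *s x) = x" using assms(2) by (simp add: vector_smult_assoc)
    ultimately show ?case by simp
  qed
qed

lemma gen_eigenspace_eq: "gen_eigenspace W M l = complexification W \<inter> gen l"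
  using gen_iff unfolding gen_eigenspace_def by auto

lemma perp_in_gen_0: "x \<in> W\<^sup>\<bottom> \<Longrightarrow> cvec x \<in> gen 0"
proof -
  assume "x \<in> W\<^sup>\<bottom>"
  then have "(shifted 0 ^^ 1) (cvec x) = 0"
    by (simp add: cplx_mult_vec kernel Finite_Cartesian_Product.vec_eq_iff)
  then show "cvec x \<in> gen 0" using gen_iff by blast
qed

lemma complexification_decomposition:
  assumes "x \<in> complexification W"
  shows "\<exists>z. x = (\<Sum>l\<in>range lam. z l) \<and> (\<forall>l\<in>range lam. z l \<in> gen l \<inter> complexification W)"
proof -
  define z where "z = (\<lambda>l. S *v (\<chi> i. if lam i = l then (T *v x) $ i else 0))"
  have zg: "z l \<in> gen l" for l by (auto simp: z_def gen_def)
  have "(\<Sum>l\<in>range lam. z l) = S *v (\<Sum>l\<in>range lam. \<chi> i. if lam i = l then (T *v x) $ i else 0)"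
    by (simp add: z_def matrix_vector_mult_sum_right)
  also have "(\<Sum>l\<in>range lam. \<chi> i. if lam i = l then (T *v x) $ i else 0) = T *v x"
    by (simp add: Finite_Cartesian_Product.vec_eq_iff)
  finally have sum: "(\<Sum>l\<in>range lam. z l) = x" by simp
  have zW: "z l \<in> complexification W" if "l \<noteq> 0" for l
    using gen_nonzero_in_complexification zg that by blast
  \<comment> \<open>The space \<open>gen 0\<close> also contains the complement of \<open>W\<close>,
    so its component is obtained as what the other components leave over.\<close>
  have z0: "z 0 \<in> complexification W" if "0 \<in> range lam"
  proof -
    have "z 0 = x - (\<Sum>l\<in>range lam - {0}. z l)"
      using sum that by (simp add: sum.remove[of "range lam" 0] eq_diff_eq)
    then show ?thesis
      using assms by (auto intro!: complexification_lincomb(2)[OF W] complexification_sum[OF W] zW)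
  qed
  have "z l \<in> gen l \<inter> complexification W" if "l \<in> range lam" for l
    using zg zW[of l] z0 that by (cases "l = 0") simp_all
  then show ?thesis using sum by (intro exI[of _ z]) simp
qed

text \<open>The description in \<open>rot\<close> must single out one matrix. Existence:
  \<open>conj_diag\<close> fixes the complement of \<open>W\<close>, which lies in
  \<open>gen 0\<close>, because 0 is not peripheral. Uniqueness: the generalised eigenspaces inside
  the complexification of \<open>W\<close> span it, and \<open>W\<close> and its complement span the
  whole space.\<close>

lemma cplx_rot:
  assumes "\<And>l. l \<in> peripheral M \<Longrightarrow> h (cnj l) = cnj (h l)"
  shows "cplx (rot W M h) = conj_diag (\<lambda>l. if l \<in> peripheral M then h l else 1)"
proof -
  let ?c = "\<lambda>l. if l \<in> peripheral M then h l else 1"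
  let ?Q = "\<lambda>R. (\<forall>l \<in> spectrum (jmat M). \<forall>x \<in> gen_eigenspace W M l.
        cplx R *v x = (if l \<in> peripheral M then h l else 1) *s x) \<and> (\<forall>x \<in> W\<^sup>\<bottom>. R *v x = x)"
  obtain R where R: "cplx R = conj_diag ?c"
  proof -
    have "?c (cnj l) = cnj (?c l)" for l using assms[of l] cnj_peripheral[of l] by simp
    then show thesis using conj_diag_real[of ?c] that by blast
  qed
  have Rp: "R *v x = x" if "x \<in> W\<^sup>\<bottom>" for x
  proof -
    have "cvec (R *v x) = ?c 0 *s cvec x"
      unfolding cplx_mult_vec[symmetric] R by (rule conj_diag_gen[OF perp_in_gen_0[OF that]])
    then have "cvec (R *v x) = cvec x" by (simp only: zero_not_peripheral if_False vector_smult_lid)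
    then show ?thesis by (simp only: cvec_eq_iff)
  qed
  have "?Q R"
    using Rp by (auto simp: R gen_eigenspace_eq conj_diag_gen)
  moreover have "R' = R" if Q: "?Q R'" for R'
  proof -
    have "R' *v x = R *v x" for x
    proof -
      obtain a b where ab: "a \<in> W" "b \<in> W\<^sup>\<bottom>" "x = a + b"
        using subspace_perp_decomposition[OF W] by blast
      obtain z where z: "cvec a = (\<Sum>l\<in>range lam. z l)" "\<forall>l\<in>range lam. z l \<in> gen l \<inter> complexification W"
        using complexification_decomposition[OF cvec_in_complexification[OF W ab(1)]] by blast
      have "cplx R' *v z l = cplx R *v z l" if "l \<in> range lam" for l
      proof -
        have "z l \<in> gen_eigenspace W M l" "l \<in> spectrum (jmat M)"
          using z(2) that by (auto simp: gen_eigenspace_eq spec)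
        then have "cplx R' *v z l = ?c l *s z l" using Q by blast
        also have "\<dots> = cplx R *v z l"
          unfolding R using z(2) that by (intro conj_diag_gen[symmetric]) blast
        finally show ?thesis .
      qed
      then have "cplx R' *v cvec a = cplx R *v cvec a"
        unfolding z(1) by (simp add: matrix_vector_mult_sum_right)
      then have "R' *v a = R *v a" by (simp only: cplx_mult_vec cvec_eq_iff)
      moreover have "R' *v b = R *v b" using Q Rp ab(2) by auto
      ultimately show ?thesis by (simp add: ab(3) matrix_vector_right_distrib)
    qed
    then show ?thesis by (simp add: matrix_eq)
  qed
  ultimately have "rot W M h = R" unfolding rot_def by (rule the_equality)
  then show ?thesis using R by simp
qed

end

section \<open>Asymptotics of the rescaled matrix powers\<close>

lemma binomial_div_power_tendsto: "(\<lambda>n. real (n choose m) / real n ^ m) \<longlonglongrightarrow> 1 / fact m"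
proof -
  have "(\<lambda>n. (\<Prod>i\<in>{0..<m}. (1 - real i / real n)) / fact m) \<longlonglongrightarrow> (\<Prod>i\<in>{0..<m}. (1 - 0)) / fact m"
    by (intro tendsto_divide tendsto_prod tendsto_diff tendsto_const lim_const_over_n) auto
  moreover have "\<forall>\<^sub>F n in sequentially. (\<Prod>i\<in>{0..<m}. (1 - real i / real n)) / fact m = real (n choose m) / real n ^ m"
    using eventually_gt_at_top[of 0]
  proof eventually_elim
    case (elim n)
    have "(\<Prod>i\<in>{0..<m}. (1 - real i / real n)) = (\<Prod>i\<in>{0..<m}. (real n - real i) / real n)"
      using elim by (intro prod.cong) (auto simp: field_simps)
    also have "\<dots> = (\<Prod>i\<in>{0..<m}. (real n - real i)) / real n ^ m" by (simp add: prod_dividef)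
    finally show ?case by (simp add: binomial_gbinomial gbinomial_prod_rev)
  qed
  ultimately show ?thesis by (simp add: Lim_transform_eventually)
qed

lemma binomial_div_power_convergent:
  assumes "m < r"
  shows "convergent (\<lambda>n. real (n choose m) / real n ^ (r - 1))"
proof -
  have "(\<lambda>n. real (n choose m) / real n ^ m * (1 / real n) ^ (r - 1 - m)) = (\<lambda>n. real (n choose m) / real n ^ (r - 1))"
  proof
    fix n
    have "real n ^ (r - 1) = real n ^ m * real n ^ (r - 1 - m)"
      using assms by (simp add: power_add[symmetric])
    then show "real (n choose m) / real n ^ m * (1 / real n) ^ (r - 1 - m) = real (n choose m) / real n ^ (r - 1)"
      by (simp add: power_one_over)
  qed
  moreover have "convergent (\<lambda>n. real (n choose m) / real n ^ m * (1 / real n) ^ (r - 1 - m))"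
    using binomial_div_power_tendsto[of m] tendsto_power[OF lim_const_over_n[of 1], of "r - 1 - m"]
    by (intro convergent_mult) (auto intro: convergentI)
  ultimately show ?thesis by simp
qed

lemma power_times_geometric_tendsto_0:
  fixes q :: real
  assumes "0 < q" "q < 1"
  shows "(\<lambda>n. real n ^ m * q ^ n) \<longlonglongrightarrow> 0"
  using assms by real_asymp


lemma tendsto_mtx_iff:
  "(F \<longlonglongrightarrow> L) \<longleftrightarrow> (\<forall>i j. (\<lambda>n. F n $ i $ j) \<longlonglongrightarrow> L $ i $ j)" for F :: "nat \<Rightarrow> 'a :: topological_space ^ 'b ^ 'c"
  by (intro iffI allI tendsto_vec_nth) (auto intro: vec_tendstoI)

lemma tendsto_mtx_mult:
  fixes F G :: "nat \<Rightarrow> complex ^ 'd ^ 'd"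
  assumes "F \<longlonglongrightarrow> A" "G \<longlonglongrightarrow> B"
  shows "(\<lambda>n. F n ** G n) \<longlonglongrightarrow> A ** B"
  using assms unfolding tendsto_mtx_iff matrix_matrix_mult_def by (auto intro!: tendsto_sum tendsto_mult)

lemma tendsto_cplx_iff: "(\<lambda>n. cplx (F n)) \<longlonglongrightarrow> cplx L \<longleftrightarrow> F \<longlonglongrightarrow> L"
  unfolding tendsto_mtx_iff by (simp add: map_matrix_def tendsto_of_real_iff)

lemma tendsto_map_cnj:
  "F \<longlonglongrightarrow> L \<Longrightarrow> (\<lambda>n. map_matrix cnj (F n)) \<longlonglongrightarrow> map_matrix cnj L"
  by (simp add: tendsto_mtx_iff map_matrix_def tendsto_cnj)

lemma of_real_entries: "(\<chi> i j. complex_of_real c * X $ i $ j) = c *\<^sub>R X"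
  by (simp add: Finite_Cartesian_Product.vec_eq_iff) (simp add: scaleR_conv_of_real)

lemma cplx_scaleR: "cplx (c *\<^sub>R A) = c *\<^sub>R cplx A"
  by (simp add: of_real_entries[symmetric] Finite_Cartesian_Product.vec_eq_iff map_matrix_def)

lemma scaleR_sandwich: "c *\<^sub>R (S ** X ** T) = S ** (c *\<^sub>R X) ** T" for S X T :: "complex ^ 'd ^ 'd"
  by (simp add: Finite_Cartesian_Product.vec_eq_iff matrix_matrix_mult_def flip: scaleR_sum_right)

text \<open>The exponent n - r + 1 may be negative for small n; splitting off the part that does not
  depend on n leaves ordinary powers of n and of the spectral radius.\<close>

lemma growth_coeff_eq:
  assumes "spec_rad M > 0"
  shows "growth_coeff M n = fact (max_jordan M - 1) * spec_rad M powi (int (max_jordan M) - 1) /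
     (real n ^ (max_jordan M - 1) * spec_rad M ^ n)"
proof -
  have "spec_rad M powi (int n - int (max_jordan M) + 1) =
      spec_rad M ^ n / spec_rad M powi (int (max_jordan M) - 1)"
    using power_int_diff[of "spec_rad M" "int n" "int (max_jordan M) - 1"] assms by (simp add: algebra_simps)
  then show ?thesis by (simp add: growth_coeff_def Let_def)
qed

context rotation_setting
begin

text \<open>The entries, in Jordan coordinates, of the sequence whose limit is P.\<close>

definition norm_coeff :: "'d \<Rightarrow> 'd \<Rightarrow> nat \<Rightarrow> complex" where
  "norm_coeff i j n = of_real (growth_coeff M n) * (inverse (phase M (lam i)) ^ n * J n $ i $ j)"

lemma norm_phase: "cmod (phase M l) = 1"
  using spec_pos by (auto simp: phase_def peripheral_def norm_divide)

lemma phase_nonzero [simp]: "phase M l \<noteq> 0"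
  using norm_phase[of l] by auto

lemma phase_cnj: "phase M (cnj l) = cnj (phase M l)"
  using cnj_peripheral[of l] by (simp add: phase_def)

lemma spectral_gap: "lam i \<notin> peripheral M \<Longrightarrow> cmod (lam i) < spec_rad M"
proof -
  assume *: "lam i \<notin> peripheral M"
  have "cmod (lam i) \<le> spec_rad M"
    unfolding spec_rad_def
    by (rule spectral_radius_mem_max(2)[OF jmat_carrier]) (auto simp: spec)
  then show ?thesis using * by (auto simp: peripheral_def spec)
qed

text \<open>This is why P exists. For a peripheral eigenvalue the inverse phase cancels the argument
  of the power, and what remains is a binomial coefficient of degree m < r over n^(r-1). For any
  other eigenvalue the ratio of its modulus to the spectral radius gives geometric decay, which
  beats the polynomial factor.\<close>

lemma convergent_norm_coeff: "convergent (norm_coeff i j)"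
  using entry[of i j]
proof
  assume "\<forall>n. J n $ i $ j = 0"
  then have "norm_coeff i j = (\<lambda>n. 0)" by (auto simp: norm_coeff_def)
  then show ?thesis by (simp add: convergent_const)
next
  let ?\<rho> = "spec_rad M" and ?r = "max_jordan M" and ?p = "phase M (lam i)"
  define C where "C = fact (?r - 1) * ?\<rho> powi (int ?r - 1)"
  have gc: "growth_coeff M n = C / (real n ^ (?r - 1) * ?\<rho> ^ n)" for n
    by (simp add: growth_coeff_eq[OF spec_pos] C_def)
  assume "\<exists>m. lam i = lam j \<and> cidx j = cidx i + m \<and> (lam i \<in> peripheral M \<longrightarrow> m < ?r) \<and>
          (\<forall>n. J n $ i $ j = of_nat (n choose m) * lam i ^ (n - m))"
  then obtain m where m: "lam i \<in> peripheral M \<Longrightarrow> m < ?r"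
    "\<And>n. J n $ i $ j = of_nat (n choose m) * lam i ^ (n - m)" by blast
  show ?thesis
  proof (cases "lam i \<in> peripheral M")
    case True
    have lam: "lam i = ?p * of_real ?\<rho>" using True spec_pos by (simp add: phase_def)
    let ?g = "\<lambda>n. of_real (real (n choose m) / real n ^ (?r - 1)) * (of_real (C / ?\<rho> ^ m) * inverse ?p ^ m)"
    obtain L\<^sub>0 where "(\<lambda>n. real (n choose m) / real n ^ (?r - 1)) \<longlonglongrightarrow> L\<^sub>0"
      using binomial_div_power_convergent[OF m(1)[OF True]] unfolding convergent_def by blast
    then have "(\<lambda>n. complex_of_real (real (n choose m) / real n ^ (?r - 1))) \<longlonglongrightarrow> of_real L\<^sub>0"
      by (rule tendsto_of_real)
    then have "convergent (\<lambda>n. complex_of_real (real (n choose m) / real n ^ (?r - 1)))"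
      by (rule convergentI)
    then have "convergent ?g" by (intro convergent_mult convergent_const)
    then obtain L where "?g \<longlonglongrightarrow> L" by (auto simp: convergent_def)
    moreover have "\<forall>\<^sub>F n in sequentially. ?g n = norm_coeff i j n"
      using eventually_ge_at_top[of m]
    proof eventually_elim
      case (elim n)
      then obtain k where n: "n = m + k" using le_Suc_ex by blast
      have "lam i ^ (n - m) = ?p ^ k * of_real (?\<rho> ^ k)" by (subst lam) (simp add: n power_mult_distrib)
      then have "norm_coeff i j n = of_real (C / (real n ^ (?r - 1) * ?\<rho> ^ n)) * (inverse ?p ^ n *
          (of_nat (n choose m) * (?p ^ k * of_real (?\<rho> ^ k))))"
        by (simp add: norm_coeff_def gc m(2))
      also have "\<dots> = ?g n"
        using spec_pos by (simp add: n power_add field_simps power_inverse)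
      finally show ?case by simp
    qed
    ultimately have "norm_coeff i j \<longlonglongrightarrow> L" by (rule Lim_transform_eventually)
    then show ?thesis by (rule convergentI)
  next
    case False
    \<comment> \<open>The midpoint lies strictly below the spectral radius and is positive even for
      eigenvalue 0, so that dividing by q^m is allowed.\<close>
    define q where "q = (cmod (lam i) + ?\<rho>) / 2"
    have q: "0 < q" "cmod (lam i) \<le> q" "q < ?\<rho>"
      using spectral_gap[OF False] spec_pos by (auto simp: q_def add_nonneg_pos)
    let ?g = "\<lambda>n. \<bar>C\<bar> / q ^ m * (real n ^ m * (q / ?\<rho>) ^ n)"
    have "(\<lambda>n. ?g n) \<longlonglongrightarrow> \<bar>C\<bar> / q ^ m * 0"
      using q spec_pos by (intro tendsto_mult tendsto_const power_times_geometric_tendsto_0) auto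
    then have "?g \<longlonglongrightarrow> 0" by simp
    moreover have "\<forall>\<^sub>F n in sequentially. cmod (norm_coeff i j n) \<le> ?g n"
      using eventually_ge_at_top[of "max m 1"]
    proof eventually_elim
      case (elim n)
      then have n: "m \<le> n" "1 \<le> n" by auto
      have "cmod (norm_coeff i j n) =
         \<bar>C\<bar> / (real n ^ (?r - 1) * ?\<rho> ^ n) * (real (n choose m) * cmod (lam i) ^ (n - m))"
        using spec_pos
        by (simp add: norm_coeff_def gc m(2) norm_mult norm_power norm_phase norm_inverse norm_divide
            power_inverse[symmetric])
      also have "\<dots> \<le> \<bar>C\<bar> / (1 * ?\<rho> ^ n) * (real n ^ m * q ^ (n - m))"
      proof (rule mult_mono)
        have "1 \<le> real n ^ (?r - 1)" using n by (simp add: one_le_power)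
        then show "\<bar>C\<bar> / (real n ^ (?r - 1) * ?\<rho> ^ n) \<le> \<bar>C\<bar> / (1 * ?\<rho> ^ n)"
          using spec_pos n by (intro divide_left_mono mult_right_mono mult_pos_pos) auto
        have "real (n choose m) \<le> real n ^ m"
          using binomial_le_pow[OF n(1)] by (metis of_nat_le_iff of_nat_power)
        then show "real (n choose m) * cmod (lam i) ^ (n - m) \<le> real n ^ m * q ^ (n - m)"
          using q by (intro mult_mono power_mono) auto
      qed (use spec_pos in auto)
      also have "\<dots> = ?g n"
        using q spec_pos n(1) by (simp add: power_diff power_divide)
      finally show ?case .
    qed
    ultimately have "norm_coeff i j \<longlonglongrightarrow> 0" by (rule Lim_null_comparison[rotated])
    then show ?thesis by (rule convergentI)
  qed
qed

definition limit_mtx :: "complex ^ 'd ^ 'd" where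
  "limit_mtx = (\<chi> i j. lim (norm_coeff i j))"

lemma norm_coeff_tendsto: "norm_coeff i j \<longlonglongrightarrow> limit_mtx $ i $ j"
  using convergent_norm_coeff by (simp add: limit_mtx_def convergent_LIMSEQ_iff)

lemma conj_diag_mult: "conj_diag a ** conj_diag b = conj_diag (\<lambda>l. a l * b l)"
proof -
  have "conj_diag a ** conj_diag b = S ** diag_mtx (\<lambda>i. a (lam i)) ** (T ** S) ** diag_mtx (\<lambda>i. b (lam i)) ** T"
    by (simp add: conj_diag_def matrix_mul_assoc)
  also have "\<dots> = S ** (diag_mtx (\<lambda>i. a (lam i)) ** diag_mtx (\<lambda>i. b (lam i))) ** T"
    by (simp add: TS matrix_mul_assoc)
  also have "diag_mtx (\<lambda>i. a (lam i)) ** diag_mtx (\<lambda>i. b (lam i)) = diag_mtx (\<lambda>i. a (lam i) * b (lam i))"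
    by (simp add: diag_mtx_mult) (auto simp: diag_mtx_def Finite_Cartesian_Product.vec_eq_iff)
  finally show ?thesis by (simp add: conj_diag_def)
qed

lemma conj_diag_one: "conj_diag (\<lambda>l. 1) = mat 1"
proof -
  have "diag_mtx (\<lambda>i::'d. 1) = mat 1" by (auto simp: diag_mtx_def Finite_Cartesian_Product.mat_def Finite_Cartesian_Product.vec_eq_iff)
  then show ?thesis by (simp add: conj_diag_def ST)
qed

lemma cplx_mat_pow: "cplx R = conj_diag c \<Longrightarrow> cplx (mat_pow R n) = conj_diag (\<lambda>l. c l ^ n)"
  by (induction n) (simp_all add: cplx_one conj_diag_one mat_pow_Suc cplx_mult conj_diag_mult)

lemma conj_diag_mult_SJT:
  "conj_diag c ** (S ** X ** T) = S ** (\<chi> i j. c (lam i) * X $ i $ j) ** T"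
proof -
  have "conj_diag c ** (S ** X ** T) = S ** diag_mtx (\<lambda>i. c (lam i)) ** (T ** S) ** X ** T"
    by (simp add: conj_diag_def matrix_mul_assoc)
  also have "\<dots> = S ** (diag_mtx (\<lambda>i. c (lam i)) ** X) ** T"
    by (simp add: TS matrix_mul_assoc)
  finally show ?thesis by (simp add: diag_mtx_mult)
qed

lemma cplx_rot_unimodular:
  assumes "\<And>l. h (cnj l) = cnj (h l)" "\<And>l. l \<notin> peripheral M \<Longrightarrow> h l = 1"
  shows "cplx (rot W M h) = conj_diag h"
proof -
  have "(\<lambda>l. if l \<in> peripheral M then h l else 1) = h" using assms(2) by auto
  then show ?thesis using cplx_rot[of h] assms(1) by simp
qed

lemma normalized_power:
  "cplx (growth_coeff M n *\<^sub>R (mat_pow (rot W M (\<lambda>l. inverse (phase M l))) n ** mat_pow M n)) =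
     S ** (\<chi> i j. norm_coeff i j n) ** T"
proof -
  have "cplx (rot W M (\<lambda>l. inverse (phase M l))) = conj_diag (\<lambda>l. inverse (phase M l))"
    by (rule cplx_rot_unimodular) (simp_all add: phase_cnj, simp add: phase_def)
  then have "cplx (mat_pow (rot W M (\<lambda>l. inverse (phase M l))) n ** mat_pow M n) =
      S ** (\<chi> i j. inverse (phase M (lam i)) ^ n * J n $ i $ j) ** T"
    by (simp add: cplx_mult cplx_mat_pow pow conj_diag_mult_SJT)
  then have "cplx (growth_coeff M n *\<^sub>R (mat_pow (rot W M (\<lambda>l. inverse (phase M l))) n ** mat_pow M n)) =
      S ** (growth_coeff M n *\<^sub>R (\<chi> i j. inverse (phase M (lam i)) ^ n * J n $ i $ j)) ** T"
    by (simp only: cplx_scaleR scaleR_sandwich)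
  then show ?thesis by (simp add: of_real_entries[symmetric] norm_coeff_def)
qed

text \<open>The limit is found in complex coordinates. As a limit of real matrices it is invariant
  under conjugation, hence real, and the \<open>lim\<close> in \<open>limit_op\<close> returns
  it.\<close>

lemma cplx_limit_op: "cplx (limit_op W M) = S ** limit_mtx ** T"
proof -
  let ?F = "\<lambda>n. growth_coeff M n *\<^sub>R (mat_pow (rot W M (\<lambda>l. inverse (phase M l))) n ** mat_pow M n)"
  have lim: "(\<lambda>n. cplx (?F n)) \<longlonglongrightarrow> S ** limit_mtx ** T"
    unfolding normalized_power
    by (intro tendsto_mtx_mult tendsto_const) (simp add: tendsto_mtx_iff norm_coeff_tendsto)
  have "map_matrix cnj (S ** limit_mtx ** T) = S ** limit_mtx ** T"
  proof (rule LIMSEQ_unique[OF _ lim])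
    have "(\<lambda>n. map_matrix cnj (cplx (?F n))) \<longlonglongrightarrow> map_matrix cnj (S ** limit_mtx ** T)"
      using lim by (rule tendsto_map_cnj)
    then show "(\<lambda>n. cplx (?F n)) \<longlonglongrightarrow> map_matrix cnj (S ** limit_mtx ** T)"
      by (simp only: map_matrix_cnj_cplx)
  qed
  then obtain L where L: "cplx L = S ** limit_mtx ** T" using cnj_eq_imp_cplx by blast
  then have "?F \<longlonglongrightarrow> L" using lim tendsto_cplx_iff[of ?F L] by simp
  then have "limit_op W M = L" unfolding limit_op_def by (rule limI)
  then show ?thesis using L by simp
qed

text \<open>An element h of the closure G together with a sequence of exponents that reaches it, so
  that properties of h can be inherited from powers of the phases.\<close>

definition phase_limit :: "(nat \<Rightarrow> nat) \<Rightarrow> (complex \<Rightarrow> complex) \<Rightarrow> bool" where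
  "phase_limit t h \<longleftrightarrow> filterlim t sequentially sequentially \<and> (\<forall>l. (\<lambda>j. phase M l ^ t j) \<longlonglongrightarrow> h l)"

lemma phase_limit_norm: "phase_limit t h \<Longrightarrow> cmod (h l) = 1"
proof -
  assume "phase_limit t h"
  then have "(\<lambda>j. cmod (phase M l ^ t j)) \<longlonglongrightarrow> cmod (h l)" by (auto simp: phase_limit_def intro: tendsto_norm)
  then have "(\<lambda>j. 1) \<longlonglongrightarrow> cmod (h l)" by (simp add: norm_power norm_phase)
  then show ?thesis by (simp add: LIMSEQ_const_iff)
qed

text \<open>From the powers of the phases h inherits compatibility with conjugation and the value 1
  off the peripheral spectrum, which makes R_h a real matrix.\<close>

lemma cplx_rot_limit_op:
  assumes "phase_limit t h"
  shows "cplx (rot W M h ** limit_op W M) = S ** (\<chi> a b. h (lam a) * limit_mtx $ a $ b) ** T"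
proof -
  have lim: "(\<lambda>j. phase M l ^ t j) \<longlonglongrightarrow> h l" for l using assms by (simp add: phase_limit_def)
  have cnj: "h (cnj l) = cnj (h l)" for l
  proof (rule LIMSEQ_unique[OF lim])
    show "(\<lambda>j. phase M (cnj l) ^ t j) \<longlonglongrightarrow> cnj (h l)"
      using tendsto_cnj[OF lim[of l]] by (simp add: phase_cnj)
  qed
  have one: "h l = 1" if "l \<notin> peripheral M" for l
    using LIMSEQ_unique[OF lim[of l]] that by (simp add: phase_def)
  show ?thesis
    by (simp add: cplx_mult cplx_rot_unimodular[of h, OF cnj one] cplx_limit_op conj_diag_mult_SJT)
qed

text \<open>The definition of P rotates the powers of M back to make them converge. Multiplying by
  the powers of the phases undoes this, and along t those powers tend to h.\<close>

lemma rescaled_power_tendsto: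
  assumes "phase_limit t h"
  shows "(\<lambda>j. growth_coeff M (t j) *\<^sub>R mat_pow M (t j)) \<longlonglongrightarrow> rot W M h ** limit_op W M"
proof -
  have lim: "(\<lambda>j. norm_coeff a b (t j)) \<longlonglongrightarrow> limit_mtx $ a $ b" for a b
    by (rule filterlim_compose[OF norm_coeff_tendsto]) (use assms in \<open>simp add: phase_limit_def\<close>)
  have "cplx (growth_coeff M n *\<^sub>R mat_pow M n) = S ** (\<chi> a b. phase M (lam a) ^ n * norm_coeff a b n) ** T" for n
  proof -
    have "phase M (lam a) ^ n * norm_coeff a b n = of_real (growth_coeff M n) * J n $ a $ b" for a b
      by (simp add: norm_coeff_def power_inverse)
    then show ?thesis by (simp add: of_real_entries cplx_scaleR pow scaleR_sandwich)
  qed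
  then have "(\<lambda>j. cplx (growth_coeff M (t j) *\<^sub>R mat_pow M (t j))) \<longlonglongrightarrow>
      S ** (\<chi> a b. h (lam a) * limit_mtx $ a $ b) ** T"
    using assms unfolding phase_limit_def
    by (simp only:, intro tendsto_mtx_mult tendsto_const)
      (auto simp: tendsto_mtx_iff intro!: tendsto_mult lim)
  then show ?thesis by (simp only: tendsto_cplx_iff cplx_rot_limit_op[OF assms, symmetric])
qed

text \<open>In Jordan coordinates h enters through factors of modulus 1 only, so the bound is
  uniform in h. It will serve all levels p, whose limit vectors belong to different h.\<close>

lemma limit_op_bounded: "\<exists>B\<ge>0. \<forall>t h. phase_limit t h \<longrightarrow> norm (rot W M h *v (limit_op W M *v x)) \<le> B"
proof -
  define K where "K = (\<lambda>a b. \<Sum>k\<in>UNIV. (\<Sum>i\<in>UNIV. cmod (S $ a $ i) * cmod (limit_mtx $ i $ k)) * cmod (T $ k $ b))"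
  have K0: "0 \<le> K a b" for a b unfolding K_def by (intro sum_nonneg mult_nonneg_nonneg) auto
  have "norm (rot W M h *v (limit_op W M *v x)) \<le> (\<Sum>a\<in>UNIV. \<Sum>b\<in>UNIV. K a b * \<bar>x $ b\<bar>)"
    if h: "phase_limit t h" for t h
  proof -
    let ?L = "rot W M h ** limit_op W M"
    have "\<bar>?L $ a $ b\<bar> \<le> K a b" for a b
    proof -
      have "\<bar>?L $ a $ b\<bar> = cmod (cplx ?L $ a $ b)" by (simp add: map_matrix_def)
      also have "\<dots> = cmod (\<Sum>k\<in>UNIV. (\<Sum>i\<in>UNIV. S $ a $ i * (h (lam i) * limit_mtx $ i $ k)) * T $ k $ b)"
        unfolding cplx_rot_limit_op[OF h] by (simp add: matrix_matrix_mult_def)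
      also have "\<dots> \<le> (\<Sum>k\<in>UNIV. cmod (\<Sum>i\<in>UNIV. S $ a $ i * (h (lam i) * limit_mtx $ i $ k)) * cmod (T $ k $ b))"
        by (rule sum_norm_le) (simp add: norm_mult)
      also have "\<dots> \<le> K a b"
        unfolding K_def
        by (intro sum_mono mult_right_mono sum_norm_le) (simp_all add: norm_mult phase_limit_norm[OF h])
      finally show ?thesis .
    qed
    then have "\<bar>(?L *v x) $ a\<bar> \<le> (\<Sum>b\<in>UNIV. K a b * \<bar>x $ b\<bar>)" for a
      unfolding matrix_vector_mult_def
      by (auto intro!: order_trans[OF sum_abs] sum_mono mult_right_mono simp: abs_mult)
    then have "(\<Sum>a\<in>UNIV. \<bar>(?L *v x) $ a\<bar>) \<le> (\<Sum>a\<in>UNIV. \<Sum>b\<in>UNIV. K a b * \<bar>x $ b\<bar>)" by (rule sum_mono)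
    moreover have "norm (?L *v x) \<le> (\<Sum>a\<in>UNIV. \<bar>(?L *v x) $ a\<bar>)" by (rule norm_le_l1_cart)
    ultimately show ?thesis by (simp add: matrix_vector_mul_assoc)
  qed
  then show ?thesis
    by (intro exI[of _ "\<Sum>a\<in>UNIV. \<Sum>b\<in>UNIV. K a b * \<bar>x $ b\<bar>"]) (auto intro!: sum_nonneg mult_nonneg_nonneg K0)
qed

lemma phase_limit_in_group:
  assumes "phase_limit t h"
  shows "h \<in> phase_group M"
proof -
  let ?X = "{(\<lambda>l. phase M l ^ n) | n. True}"
  have "limitin (product_topology (\<lambda>_. euclidean) UNIV) (\<lambda>j l. phase M l ^ t j) h sequentially"
    using assms by (simp add: limitin_componentwise phase_limit_def)
  then have "(\<lambda>j l. phase M l ^ t j) \<longlonglongrightarrow> h"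
    by (simp add: euclidean_product_topology)
  then have "h \<in> closure ?X"
    by (rule Lim_in_closed_set[rotated 3]) (auto intro!: always_eventually closure_subset[THEN subsetD])
  then show ?thesis by (simp add: phase_group_def)
qed

text \<open>Only the finitely many peripheral phases vary. They all occur among the
  \<open>lam i\<close>, so compactness of bounded sets in \<open>complex ^ 'd\<close> provides the
  subsequence.\<close>

lemma phase_limit_subsequence:
  fixes s :: "nat \<Rightarrow> nat"
  assumes "strict_mono s"
  shows "\<exists>r h. strict_mono r \<and> phase_limit (s \<circ> r) h"
proof -
  define X where "X = (\<lambda>j. (\<chi> i. phase M (lam i) ^ s j) :: complex ^ 'd)"
  have "norm (X j) \<le> CARD('d)" for j
  proof -
    have "norm (X j) \<le> (\<Sum>i\<in>UNIV. norm (X j $ i))" unfolding norm_vec_def by (rule L2_set_le_sum) simp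
    then show ?thesis by (simp add: X_def norm_power norm_phase)
  qed
  then have "bounded (range X)" by (auto simp: bounded_iff)
  then obtain L r where r: "strict_mono r" "(X \<circ> r) \<longlonglongrightarrow> L"
    using bounded_imp_convergent_subsequence[of X] by blast
  define h where "h = (\<lambda>l. lim (\<lambda>j. phase M l ^ s (r j)))"
  have "(\<lambda>j. phase M l ^ s (r j)) \<longlonglongrightarrow> h l" for l
  proof (cases "l \<in> peripheral M")
    case True
    then obtain i where "l = lam i" by (auto simp: peripheral_def spec)
    then have "(\<lambda>j. phase M l ^ s (r j)) \<longlonglongrightarrow> L $ i"
      using tendsto_vec_nth[OF r(2), of i] by (simp add: X_def)
    then show ?thesis unfolding h_def by (simp add: limI)
  next
    case False
    then show ?thesis by (simp add: h_def phase_def)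
  qed
  moreover have "filterlim (s \<circ> r) sequentially sequentially"
    by (intro filterlim_subseq strict_mono_o assms r(1))
  ultimately show ?thesis using r(1) by (auto simp: phase_limit_def)
qed

lemma phase_limit_shift:
  assumes "phase_limit t h"
  shows "phase_limit (\<lambda>j. t j - p) (\<lambda>l. h l * inverse (phase M l) ^ p)"
proof -
  have t: "filterlim t sequentially sequentially" using assms by (simp add: phase_limit_def)
  have "filterlim (\<lambda>j. t j - p) sequentially sequentially"
    using filterlim_compose[OF filterlim_minus_const_nat_at_top t] .
  moreover have "(\<lambda>j. phase M l ^ (t j - p)) \<longlonglongrightarrow> h l * inverse (phase M l) ^ p" for l
  proof -
    have "(\<lambda>j. phase M l ^ t j * inverse (phase M l) ^ p) \<longlonglongrightarrow> h l * inverse (phase M l) ^ p"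
      using assms by (intro tendsto_mult tendsto_const) (simp add: phase_limit_def)
    moreover have "\<forall>\<^sub>F j in sequentially. phase M l ^ t j * inverse (phase M l) ^ p = phase M l ^ (t j - p)"
      using t[unfolded filterlim_at_top, rule_format, of p]
      by eventually_elim (simp add: power_diff power_inverse divide_inverse)
    ultimately show ?thesis by (rule Lim_transform_eventually)
  qed
  ultimately show ?thesis by (simp add: phase_limit_def)
qed

lemma growth_coeff_ratio:
  "(\<lambda>n. growth_coeff M n / growth_coeff M (n - p)) \<longlonglongrightarrow> 1 / spec_rad M ^ p"
proof -
  let ?r = "max_jordan M - 1"
  have "(\<lambda>n. 1 - real p / real n) \<longlonglongrightarrow> 1 - 0" by (intro tendsto_diff tendsto_const lim_const_over_n)
  then have "(\<lambda>n. (1 - real p / real n) ^ ?r / spec_rad M ^ p) \<longlonglongrightarrow> 1 ^ ?r / spec_rad M ^ p"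
    using spec_pos by (intro tendsto_divide tendsto_power tendsto_const) auto
  moreover have "\<forall>\<^sub>F n in sequentially. (1 - real p / real n) ^ ?r / spec_rad M ^ p
     = growth_coeff M n / growth_coeff M (n - p)"
    using eventually_gt_at_top[of p]
  proof eventually_elim
    case (elim n)
    then obtain k where n: "n = p + k" "k > 0" using less_imp_add_positive by blast
    have "1 - real p / real n = real k / real n" using n by (simp add: field_simps)
    then show ?case
      using spec_pos n by (simp add: growth_coeff_eq[OF spec_pos] power_divide power_add field_simps)
  qed
  ultimately show ?thesis by (simp add: Lim_transform_eventually)
qed

lemma growth_coeff_pos: "n > 0 \<Longrightarrow> growth_coeff M n > 0"
  using spec_pos by (simp add: growth_coeff_eq[OF spec_pos])

text \<open>Normalising by c_n instead of c_(n-p) is the origin of the factor \<rho>^(-p): the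
  polynomial parts of the two coefficients have ratio tending to 1.\<close>

lemma shifted_power_tendsto:
  assumes "phase_limit t h"
  shows "(\<lambda>j. growth_coeff M (t j) *\<^sub>R (mat_pow M (t j - p) *v x)) \<longlonglongrightarrow>
    (1 / spec_rad M ^ p) *\<^sub>R (rot W M (\<lambda>l. h l * inverse (phase M l) ^ p) *v (limit_op W M *v x))"
proof -
  have t: "filterlim t sequentially sequentially" using assms by (simp add: phase_limit_def)
  let ?L = "rot W M (\<lambda>l. h l * inverse (phase M l) ^ p) ** limit_op W M"
  have "(\<lambda>j. growth_coeff M (t j - p) *\<^sub>R mat_pow M (t j - p)) \<longlonglongrightarrow> ?L"
    by (rule rescaled_power_tendsto[OF phase_limit_shift[OF assms]])
  then have "(\<lambda>j. (growth_coeff M (t j - p) *\<^sub>R mat_pow M (t j - p)) *v x) \<longlonglongrightarrow> ?L *v x"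
    unfolding tendsto_mtx_iff by (intro vec_tendstoI) (auto simp: matrix_vector_mult_def intro!: tendsto_sum tendsto_mult)
  then have "(\<lambda>j. (growth_coeff M (t j) / growth_coeff M (t j - p)) *\<^sub>R
      ((growth_coeff M (t j - p) *\<^sub>R mat_pow M (t j - p)) *v x)) \<longlonglongrightarrow> (1 / spec_rad M ^ p) *\<^sub>R (?L *v x)"
    by (intro tendsto_scaleR filterlim_compose[OF growth_coeff_ratio t])
  moreover have "\<forall>\<^sub>F j in sequentially. (growth_coeff M (t j) / growth_coeff M (t j - p)) *\<^sub>R
      ((growth_coeff M (t j - p) *\<^sub>R mat_pow M (t j - p)) *v x) = growth_coeff M (t j) *\<^sub>R (mat_pow M (t j - p) *v x)"
    using t[unfolded filterlim_at_top, rule_format, of "Suc p"]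
  proof eventually_elim
    case (elim j)
    then have "growth_coeff M (t j - p) \<noteq> 0" using growth_coeff_pos[of "t j - p"] by simp
    then show ?case by (simp add: scaleR_matrix_vector_assoc[symmetric])
  qed
  ultimately show ?thesis
    by (simp add: Lim_transform_eventually matrix_vector_mul_assoc)
qed

end

section \<open>Orthogonal compressions and digit words\<close>

text \<open>An orthonormal basis of \<open>W\<close> yields one such matrix. It is the only one,
  since the difference of two values lies both in \<open>W\<close> and in its complement and is
  therefore orthogonal to itself.\<close>

lemma orth_proj_props:
  fixes W :: "(real ^ 'd) set"
  assumes "subspace W"
  shows "orth_proj W *v x \<in> W" "x - orth_proj W *v x \<in> W\<^sup>\<bottom>"
proof -
  have "\<exists>B\<subseteq>W. pairwise Linear_Algebra.orthogonal B \<and> (\<forall>x\<in>B. norm x = 1) \<and> span B = W"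
    by (meson assms orthonormal_basis_subspace)
  then obtain B where B: "B \<subseteq> W" "pairwise Linear_Algebra.orthogonal B" "\<And>x. x \<in> B \<Longrightarrow> norm x = 1" "span B = W"
    by blast
  have fin: "finite B" using B(2,3) pairwise_orthogonal_imp_finite by blast
  define P where "P = matrix (\<lambda>x. \<Sum>b\<in>B. (x \<bullet> b) *\<^sub>R b)"
  have "linear (\<lambda>x. \<Sum>b\<in>B. (x \<bullet> b) *\<^sub>R b)"
    by (rule linearI) (simp_all add: inner_add_left scaleR_add_left sum.distrib scaleR_sum_right)
  then have "(*v) P = (\<lambda>x. \<Sum>b\<in>B. (x \<bullet> b) *\<^sub>R b)"
    unfolding P_def by (rule matrix_vector_mul(2))
  then have Pv: "P *v x = (\<Sum>b\<in>B. (x \<bullet> b) *\<^sub>R b)" for x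
    by (rule fun_cong)
  have PW: "P *v x \<in> W" for x
    unfolding Pv using B(1) by (intro subspace_sum[OF assms] subspace_scale[OF assms]) auto
  have perp: "x - P *v x \<in> W\<^sup>\<bottom>" for x
  proof -
    have "(x - P *v x) \<bullet> c = 0" if c: "c \<in> B" for c
    proof -
      have "(P *v x) \<bullet> c = (\<Sum>b\<in>B. if b = c then x \<bullet> c else 0)"
        unfolding Pv inner_sum_left using B(2,3) c
        by (intro sum.cong) (auto simp: pairwise_def Linear_Algebra.orthogonal_def dot_square_norm)
      also have "\<dots> = x \<bullet> c" using fin c by simp
      finally show ?thesis by (simp add: inner_diff_left)
    qed
    then have "Linear_Algebra.orthogonal (x - P *v x) y" if "y \<in> span B" for y
      by (intro orthogonal_to_span[OF that]) (simp only: Linear_Algebra.orthogonal_def)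
    then show ?thesis by (simp add: orthogonal_comp_def orthogonal_commute B(4))
  qed
  have uniq: "Q = P" if Q: "\<forall>x. Q *v x \<in> W \<and> x - Q *v x \<in> W\<^sup>\<bottom>" for Q
  proof -
    have "Q *v x = P *v x" for x
    proof -
      let ?d = "Q *v x - P *v x"
      have "?d \<in> W" using Q PW by (blast intro: subspace_diff[OF assms])
      moreover have "?d = (x - P *v x) - (x - Q *v x)" by simp
      then have "?d \<in> W\<^sup>\<bottom>" using Q perp by (metis subspace_diff subspace_orthogonal_comp)
      ultimately have "?d \<bullet> ?d = 0" by (auto simp: orthogonal_comp_def Linear_Algebra.orthogonal_def)
      then show ?thesis by simp
    qed
    then show ?thesis by (simp add: matrix_eq)
  qed
  have "orth_proj W = P" unfolding orth_proj_def
    by (rule the_equality) (use PW perp uniq in auto)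
  then show "orth_proj W *v x \<in> W" "x - orth_proj W *v x \<in> W\<^sup>\<bottom>" using PW perp by auto
qed

lemma perp_inner: "x \<in> W\<^sup>\<bottom> \<Longrightarrow> y \<in> W \<Longrightarrow> y \<bullet> x = 0"
  by (auto simp: orthogonal_comp_def Linear_Algebra.orthogonal_def)

lemma inner_orth_proj:
  assumes "subspace W" "y \<in> W"
  shows "y \<bullet> (orth_proj W *v x) = y \<bullet> x"
  using perp_inner[OF orth_proj_props(2)[OF assms(1), of x] assms(2)] by (simp add: inner_diff_right)

lemma orth_proj_eq_self:
  assumes "subspace W" "x \<in> W"
  shows "orth_proj W *v x = x"
proof -
  let ?d = "x - orth_proj W *v x"
  have "?d \<in> W" using orth_proj_props(1)[OF assms(1)] assms by (blast intro: subspace_diff)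
  then have "?d \<bullet> ?d = 0" using orth_proj_props(2)[OF assms(1), of x] by (rule perp_inner[rotated])
  then show ?thesis by simp
qed

lemma orth_proj_perp:
  assumes "subspace W" "x \<in> W\<^sup>\<bottom>"
  shows "orth_proj W *v x = 0"
proof -
  have "(orth_proj W *v x) \<bullet> (orth_proj W *v x) = 0"
    using inner_orth_proj[OF assms(1) orth_proj_props(1)[OF assms(1)], of x x]
      perp_inner[OF assms(2) orth_proj_props(1)[OF assms(1)]] by simp
  then show ?thesis by simp
qed

lemma compress_vec: "compress W M *v x = orth_proj W *v (M *v (orth_proj W *v x))"
  by (simp add: compress_def matrix_vector_mul_assoc matrix_mul_assoc)

lemma compress_in: "subspace W \<Longrightarrow> compress W M *v x \<in> W"
  by (simp add: compress_vec orth_proj_props)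

lemma compress_perp: "subspace W \<Longrightarrow> x \<in> W\<^sup>\<bottom> \<Longrightarrow> compress W M *v x = 0"
  by (simp add: compress_vec orth_proj_perp)

lemma compress_invariant:
  assumes "subspace W" "x \<in> W" "M *v x \<in> W"
  shows "compress W M *v x = M *v x"
  using assms by (simp add: compress_vec orth_proj_eq_self)

text \<open>The row y, lying in \<open>W\<close>, absorbs the outer projection, and the row y M,
  again in \<open>W\<close>, absorbs the inner one.\<close>

lemma inner_compress:
  assumes "subspace W" "y \<in> W" "y v* M \<in> W"
  shows "y \<bullet> (compress W M *v x) = y \<bullet> (M *v x)"
proof -
  have "y \<bullet> (compress W M *v x) = (y v* M) \<bullet> (orth_proj W *v x)"
    using assms by (simp add: compress_vec inner_orth_proj dot_lmul_matrix)
  also have "\<dots> = (y v* M) \<bullet> x" by (rule inner_orth_proj[OF assms(1,3)])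
  finally show ?thesis by (simp only: dot_lmul_matrix)
qed

lemma sum_mtx_vec: "(\<Sum>i\<in>I. A i :: real ^ 'd ^ 'd) *v x = (\<Sum>i\<in>I. A i *v x)"
  by (induction I rule: infinite_finite_induct) (simp_all add: matrix_vector_mult_add_rdistrib)

lemma vec_mtx_sum: "(A :: real ^ 'd ^ 'd) *v (\<Sum>i\<in>I. x i) = (\<Sum>i\<in>I. A *v x i)"
  by (induction I rule: infinite_finite_induct) (simp_all add: matrix_vector_right_distrib)

lemma compress_sum: "compress W (\<Sum>i\<in>I. A i) = (\<Sum>i\<in>I. compress W (A i))"
  by (simp add: matrix_eq sum_mtx_vec compress_vec vec_mtx_sum)

section \<open>Digit words and blocks of integers\<close>

lemma word_prod_Nil [simp]: "word_prod A [] = mat 1"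
  and word_prod_Cons [simp]: "word_prod A (i # w) = A i ** word_prod A w"
  by (simp_all add: word_prod_def)

lemma word_prod_append: "word_prod A (w @ w') = word_prod A w ** word_prod A w'"
  by (induction w) (simp_all add: matrix_mul_assoc)

definition words :: "nat \<Rightarrow> nat \<Rightarrow> nat list set" where
  "words k p = {w. set w \<subseteq> {..<k} \<and> length w = p}"

lemma finite_words [simp]: "finite (words k p)"
  using finite_lists_length_eq[of "{..<k}" p] by (simp add: words_def)

lemma words_0 [simp]: "words k 0 = {[]}"
  by (auto simp: words_def)

text \<open>For i >= 1 this is the integer whose expansion is that of i followed by w; the leading i
  allows w to begin with zeros.\<close>

definition digit_value :: "nat \<Rightarrow> nat \<Rightarrow> nat list \<Rightarrow> nat" where
  "digit_value k i w = foldl (\<lambda>n j. k * n + j) i w"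

lemma digit_value_Nil [simp]: "digit_value k i [] = i"
  and digit_value_snoc [simp]: "digit_value k i (w @ [j]) = k * digit_value k i w + j"
  by (simp_all add: digit_value_def)

lemma base_digits_step:
  assumes "2 \<le> k" "1 \<le> n" "i < k"
  shows "base_digits k (k * n + i) = base_digits k n @ [i]"
  using assms by (subst base_digits.simps) auto

lemma base_digits_0 [simp]: "base_digits k 0 = []"
  by (simp add: base_digits.simps)

lemma base_digits_digit:
  assumes "2 \<le> k" "1 \<le> i" "i < k"
  shows "base_digits k i = [i]"
  using assms by (subst base_digits.simps) auto

lemma digit_value_bounds:
  assumes "2 \<le> k" "w \<in> words k p"
  shows "i * k ^ p \<le> digit_value k i w" "digit_value k i w < Suc i * k ^ p"
proof -
  have "i * k ^ length w \<le> digit_value k i w \<and> digit_value k i w < Suc i * k ^ length w" if "set w \<subseteq> {..<k}"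
    using that
  proof (induction w rule: rev_induct)
    case (snoc j w)
    \<comment> \<open>The upper bound is carried as \<open>Suc _ \<le> _\<close>, so that
      multiplication by k leaves room for the next digit.\<close>
    then have IH: "i * k ^ length w \<le> digit_value k i w" "Suc (digit_value k i w) \<le> Suc i * k ^ length w" and j: "j < k"
      by auto
    have "i * k ^ Suc (length w) \<le> k * digit_value k i w"
      using mult_le_mono2[OF IH(1), of k] by (simp only: power_Suc mult.left_commute[of k i])
    moreover have "k * digit_value k i w + k \<le> Suc i * k ^ Suc (length w)"
      using mult_le_mono2[OF IH(2), of k]
      by (simp only: power_Suc mult.left_commute[of k "Suc i"] mult_Suc_right add.commute[of k])
    moreover have "length (w @ [j]) = Suc (length w)" by simp
    ultimately show ?case using j by (simp only: digit_value_snoc) linarith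
  qed simp
  then show "i * k ^ p \<le> digit_value k i w" "digit_value k i w < Suc i * k ^ p"
    using assms(2) by (auto simp: words_def)
qed

lemma base_digits_digit_value:
  assumes "2 \<le> k" "1 \<le> a" "set w \<subseteq> {..<k}"
  shows "base_digits k (digit_value k a w) = base_digits k a @ w"
  using assms(3)
proof (induction w rule: rev_induct)
  case (snoc j w)
  have "1 * 1 \<le> a * k ^ length w" using assms by (intro mult_le_mono) auto
  also have "\<dots> \<le> digit_value k a w"
    using snoc by (intro digit_value_bounds(1)[OF assms(1)]) (auto simp: words_def)
  finally have "1 \<le> digit_value k a w" by simp
  then show ?case using snoc assms(1) by (simp add: base_digits_step)
qed simp

lemma sum_nat_blocks: "(\<Sum>n = k * a..<k * b. F n) = (\<Sum>m = a..<b. \<Sum>i<k. F (k * m + i))" for F :: "nat \<Rightarrow> 'a :: comm_monoid_add"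
proof (cases "a \<le> b")
  case True
  then show ?thesis
  proof (induction b rule: dec_induct)
    case (step b)
    have "(\<Sum>n = k * a..<k * Suc b. F n) = (\<Sum>n = k * a..<k * b. F n) + (\<Sum>n = k * b..<k * Suc b. F n)"
      using step by (intro sum.atLeastLessThan_concat[symmetric]) auto
    also have "(\<Sum>n = k * b..<k * Suc b. F n) = (\<Sum>i<k. F (k * b + i))"
      using sum.shift_bounds_nat_ivl[of F 0 "k * b" k] by (simp add: lessThan_atLeast0 add.commute)
    finally show ?case using step by simp
  qed simp
next
  case False
  then have "k * b \<le> k * a" by simp
  then show ?thesis using False by simp
qed

lemma words_Suc_sum:
  "(\<Sum>w\<in>words k (Suc p). F w) = (\<Sum>w\<in>words k p. \<Sum>j<k. F (w @ [j]))" for F :: "nat list \<Rightarrow> 'a :: comm_monoid_add"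
proof -
  have "(\<Sum>w\<in>words k p. \<Sum>j<k. F (w @ [j])) = (\<Sum>(w, j)\<in>words k p \<times> {..<k}. F (w @ [j]))"
    by (simp add: sum.cartesian_product)
  also have "\<dots> = (\<Sum>w\<in>words k (Suc p). F w)"
  proof (rule sum.reindex_bij_witness[where i = "\<lambda>w. (butlast w, last w)" and j = "\<lambda>(w, j). w @ [j]"])
    fix w assume w: "w \<in> words k (Suc p)"
    then have "w \<noteq> []" by (auto simp: words_def)
    then obtain v j where v: "w = v @ [j]" by (metis append_butlast_last_id)
    then show "(case (butlast w, last w) of (w, j) \<Rightarrow> w @ [j]) = w"
      "(butlast w, last w) \<in> words k p \<times> {..<k}" using w by (auto simp: words_def)
  qed (auto simp: words_def)
  finally show ?thesis by simp
qed

lemma sum_digit_value: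
  "(\<Sum>n = i * k ^ p..<Suc i * k ^ p. F n) = (\<Sum>w\<in>words k p. F (digit_value k i w))" for F :: "nat \<Rightarrow> 'a :: comm_monoid_add"
proof (induction p arbitrary: F)
  case (Suc p)
  have "(\<Sum>n = i * k ^ Suc p..<Suc i * k ^ Suc p. F n) = (\<Sum>n = k * (i * k ^ p)..<k * (Suc i * k ^ p). F n)"
    by (simp only: power_Suc mult.left_commute)
  then show ?case unfolding sum_nat_blocks words_Suc_sum Suc by simp
qed simp

lemma sum_consecutive_blocks:
  fixes F :: "nat \<Rightarrow> 'a :: comm_monoid_add"
  assumes "a \<le> b"
  shows "(\<Sum>n = a * q..<b * q. F n) = (\<Sum>i = a..<b. \<Sum>n = i * q..<Suc i * q. F n)"
  using assms
proof (induction b rule: dec_induct)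
  case (step b)
  have "(\<Sum>n = a * q..<Suc b * q. F n) = (\<Sum>n = a * q..<b * q. F n) + (\<Sum>n = b * q..<Suc b * q. F n)"
    using step by (intro sum.atLeastLessThan_concat[symmetric]) auto
  then show ?case using step by simp
qed simp

section \<open>Spectral radius and invariant subspaces\<close>

text \<open>A generalised eigenvector of the compression for a nonzero eigenvalue lies in the
  complexification of \<open>U\<close>, where the compression acts as \<open>M\<close>. Eigenvalue 0
  may stem from the complement of \<open>U\<close> and is covered by the sign assumption.\<close>

lemma spec_rad_compress_le:
  fixes M :: "real ^ 'd ^ 'd"
  assumes U: "subspace U" and inv: "\<And>x. x \<in> U \<Longrightarrow> M *v x \<in> U" and nonneg: "spec_rad M \<ge> 0"
  shows "spec_rad (compress U M) \<le> spec_rad M"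
proof (cases "spec_rad (compress U M) > 0")
  case True
  obtain S T J lam where "jordan_data (compress U M) S T J lam" using ex_jordan_data by blast
  then interpret H: rotation_setting "compress U M" S T J lam U
    using U True by unfold_locales (auto simp: compress_in compress_perp)
  obtain S' T' J' lam' where "jordan_data M S' T' J' lam'" using ex_jordan_data by blast
  then interpret M: jordan_setting M S' T' J' lam' by unfold_locales
  have "spec_rad (compress U M) \<in> cmod ` range lam"
    using spectral_radius_mem_max(1)[OF jmat_carrier, of "compress U M"] unfolding spec_rad_def H.spec by simp
  then obtain l where l: "l \<in> range lam" "cmod l = spec_rad (compress U M)" by (metis imageE)
  have l0: "l \<noteq> 0" using l(2) True by auto
  obtain x where x: "x \<in> H.gen l" "x \<noteq> 0" using l(1) H.range_lam_iff by blast
  have cM: "cplx (compress U M) *v y = cplx M *v y" if "y \<in> complexification U" for y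
  proof -
    have *: "cplx N *v y = cvec (N *v (\<chi> i. Re (y $ i))) + \<i> *s cvec (N *v (\<chi> i. Im (y $ i)))" for N :: "real ^ 'd ^ 'd"
      by (simp add: Finite_Cartesian_Product.vec_eq_iff map_matrix_def matrix_vector_mult_def complex_eq_iff)
    show ?thesis
      using that unfolding * complexification_def by (simp add: compress_invariant U inv)
  qed
  have "(M.shifted l ^^ j) x = (H.shifted l ^^ j) x \<and> (H.shifted l ^^ j) x \<in> complexification U" for j
  proof (induction j)
    case 0
    then show ?case using H.gen_nonzero_in_complexification[OF x(1) l0] by simp
  next
    case (Suc j)
    let ?y = "(H.shifted l ^^ j) x"
    have y: "?y \<in> complexification U" using Suc by blast
    then have "H.shifted l ?y \<in> complexification U"
      by (rule complexification_lincomb(2)[OF U cplx_mult_in_complexification[OF H.range]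
            complexification_lincomb(3)[OF U _ complexification_0[OF U]]])
    then show ?case using Suc cM[OF y] by simp
  qed
  moreover obtain j where "(H.shifted l ^^ j) x = 0" using x(1) H.gen_iff by blast
  ultimately have "(M.shifted l ^^ j) x = 0" by simp
  then have "x \<in> M.gen l" using M.gen_iff by blast
  then have "l \<in> spectrum (jmat M)" using x(2) M.range_lam_iff M.spec by blast
  then have "cmod l \<le> spec_rad M"
    unfolding spec_rad_def by (intro spectral_radius_mem_max(2)[OF jmat_carrier]) auto
  then show ?thesis using l(2) by simp
qed (use nonneg in simp)

lemma v_mult_eq_transpose: "x v* A = transpose A *v (x :: real ^ 'd)" for A :: "real ^ 'd ^ 'd"
  by (simp add: transpose_matrix_vector)

lemma sum_words: "(\<Sum>w\<in>words k q. word_prod A w *v x) = mat_pow (\<Sum>i<k. A i) q *v x"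
proof (induction q arbitrary: x)
  case (Suc q)
  have "(\<Sum>w\<in>words k (Suc q). word_prod A w *v x) = (\<Sum>w\<in>words k q. word_prod A w *v ((\<Sum>i<k. A i) *v x))"
    unfolding words_Suc_sum
    by (simp add: word_prod_append sum_mtx_vec vec_mtx_sum matrix_vector_mul_assoc)
  then show ?case by (simp add: Suc mat_pow_Suc2 flip: matrix_vector_mul_assoc)
qed simp

section \<open>From the sequence to compressed and reduced matrices\<close>

locale representation =
  fixes k :: nat and f :: "nat \<Rightarrow> real" and u v :: "real ^ 'd" and A :: "nat \<Rightarrow> real ^ 'd ^ 'd"
  assumes k: "2 \<le> k" and rep: "linear_representation k f u A v"
begin

abbreviation "V \<equiv> row_space k u A"
abbreviation "At \<equiv> tilde k u A"
abbreviation "Mt \<equiv> tilde_sum k u A"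
abbreviation "U \<equiv> reduced_space k u A v"
abbreviation "Ah \<equiv> hat k u A v"

lemma subspace_V: "subspace V" by (simp add: row_space_def)
lemma subspace_U: "subspace U" by (simp add: reduced_space_def)

lemma num_prod_digit_value:
  "1 \<le> a \<Longrightarrow> set w \<subseteq> {..<k} \<Longrightarrow> num_prod k B (digit_value k a w) = num_prod k B a ** word_prod B w"
  by (simp add: num_prod_def base_digits_digit_value[OF k] word_prod_append)

text \<open>Multiplying a generator by \<open>A j\<close> appends the digit j to n, and the number
  stays at least 1.\<close>

lemma row_space_invariant:
  assumes "y \<in> V" "j < k"
  shows "y v* A j \<in> V"
  using assms(1) unfolding row_space_def
proof (rule span_induct)
  show "subspace {y. y v* A j \<in> span {u v* num_prod k A n |n. 1 \<le> n}}"
    unfolding v_mult_eq_transpose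
    by (auto intro!: subspaceI simp del: transpose_matrix_vector simp: matrix_vector_right_distrib matrix_vector_mult_scaleR
        span_add span_scale span_zero)
next
  fix x assume "x \<in> {u v* num_prod k A n |n. 1 \<le> n}"
  then obtain n where n: "1 \<le> n" "x = u v* num_prod k A n" by blast
  have "x v* A j = u v* num_prod k A (digit_value k n [j])"
    using num_prod_digit_value[OF n(1), of "[j]" A] assms(2) n(2)
    by (simp add: vector_matrix_mul_assoc)
  moreover have "1 \<le> digit_value k n [j]"
  proof -
    have "n \<le> k * n" using k by simp
    then show ?thesis using n(1) unfolding digit_value_def foldl.simps by linarith
  qed
  ultimately show "x v* A j \<in> span {u v* num_prod k A n |n. 1 \<le> n}"
    by (auto intro!: span_base)
qed

lemma leading_row_in: "1 \<le> i \<Longrightarrow> i < k \<Longrightarrow> u v* A i \<in> V"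
  unfolding row_space_def
  by (rule span_base) (auto intro!: exI[of _ i] simp: num_prod_def base_digits_digit[OF k])

lemma inner_tilde: "y \<in> V \<Longrightarrow> i < k \<Longrightarrow> y \<bullet> (At i *v z) = y \<bullet> (A i *v z)"
  unfolding tilde_def by (intro inner_compress subspace_V row_space_invariant)

text \<open>The vectors a and b are ones that no row in \<open>V\<close> can tell apart. Moving the
  first letter over to the row leaves the row in \<open>V\<close>, so the letters are exchanged one
  at a time.\<close>

lemma inner_word:
  assumes "\<And>y. y \<in> V \<Longrightarrow> y \<bullet> a = y \<bullet> b" "set w \<subseteq> {..<k}" "y \<in> V"
  shows "y \<bullet> (word_prod A w *v a) = y \<bullet> (word_prod At w *v b)"
  using assms(2,3)
proof (induction w arbitrary: y)
  case (Cons i w)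
  have "y \<bullet> (word_prod A (i # w) *v a) = (y v* A i) \<bullet> (word_prod A w *v a)"
    by (simp add: dot_lmul_matrix matrix_vector_mul_assoc)
  also have "\<dots> = (y v* A i) \<bullet> (word_prod At w *v b)"
    using Cons by (intro Cons.IH row_space_invariant) auto
  also have "\<dots> = y \<bullet> (At i *v (word_prod At w *v b))"
    using Cons.prems by (simp add: dot_lmul_matrix inner_tilde)
  finally show ?case by (simp add: matrix_vector_mul_assoc)
qed (use assms(1) in simp)

lemma inner_power:
  assumes "y \<in> V"
  shows "y \<bullet> (mat_pow (\<Sum>i<k. A i) q *v x) = y \<bullet> (mat_pow Mt q *v x)"
proof -
  have "Mt = (\<Sum>i<k. At i)" by (simp add: tilde_sum_def tilde_def compress_sum)
  then have "mat_pow Mt q *v x = (\<Sum>w\<in>words k q. word_prod At w *v x)" by (simp add: sum_words)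
  moreover have "y \<bullet> (word_prod A w *v x) = y \<bullet> (word_prod At w *v x)" if "w \<in> words k q" for w
    using that assms by (intro inner_word) (auto simp: words_def)
  ultimately show ?thesis by (simp add: sum_words[symmetric] inner_sum_right)
qed

lemma f_block_sum:
  assumes "1 \<le> a"
  shows "(\<Sum>n = a * k ^ q..<Suc a * k ^ q. f n) = u \<bullet> (num_prod k A a *v (mat_pow (\<Sum>i<k. A i) q *v v))"
proof -
  have "(\<Sum>n = a * k ^ q..<Suc a * k ^ q. f n) = (\<Sum>w\<in>words k q. u \<bullet> (num_prod k A a *v (word_prod A w *v v)))"
    unfolding sum_digit_value using rep assms
    by (intro sum.cong)
      (auto simp: linear_representation_def num_prod_digit_value words_def matrix_vector_mul_assoc)
  then show ?thesis by (simp add: inner_sum_right vec_mtx_sum flip: sum_words)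
qed

text \<open>This is the unnormalised mass of a cell at level p when N = p + q. The leading matrix
  stays uncompressed: it is the row \<open>u v* A i\<close> that is known to lie in
  \<open>V\<close>, while u itself may lie outside.\<close>

lemma cylinder_sum:
  assumes "1 \<le> i" "i < k" "w \<in> words k p"
  shows "(\<Sum>n = digit_value k i w * k ^ q..<Suc (digit_value k i w) * k ^ q. f n) =
    (u v* A i) \<bullet> (word_prod At w *v (mat_pow Mt q *v v))"
proof -
  have w: "set w \<subseteq> {..<k}" using assms(3) by (simp add: words_def)
  have "1 * 1 \<le> i * k ^ p" using assms k by (intro mult_le_mono) auto
  also have "\<dots> \<le> digit_value k i w" using digit_value_bounds(1)[OF k assms(3)] .
  finally have "1 \<le> digit_value k i w" by simp
  then have "(\<Sum>n = digit_value k i w * k ^ q..<Suc (digit_value k i w) * k ^ q. f n) =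
      u \<bullet> (num_prod k A (digit_value k i w) *v (mat_pow (\<Sum>i<k. A i) q *v v))"
    by (rule f_block_sum)
  also have "num_prod k A (digit_value k i w) = A i ** word_prod A w"
    using assms w by (simp add: num_prod_digit_value) (simp add: num_prod_def base_digits_digit[OF k])
  also have "u \<bullet> ((A i ** word_prod A w) *v (mat_pow (\<Sum>i<k. A i) q *v v)) =
      (u v* A i) \<bullet> (word_prod A w *v (mat_pow (\<Sum>i<k. A i) q *v v))"
    by (simp add: dot_lmul_matrix matrix_vector_mul_assoc matrix_mul_assoc)
  also have "\<dots> = (u v* A i) \<bullet> (word_prod At w *v (mat_pow Mt q *v v))"
    by (intro inner_word inner_power w leading_row_in assms)
  finally show ?thesis .
qed

text \<open>Leading digits run from 1 to k - 1, whence A - A_0, the matrix in the nondegeneracy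
  condition.\<close>

lemma block_sum_eq: "block_sum k f N = u \<bullet> (((\<Sum>i<k. A i) - A 0) *v (mat_pow Mt N *v v))"
proof -
  have "block_sum k f N = (\<Sum>n = 1 * k ^ N..<k * k ^ N. f n)" by (simp add: block_sum_def)
  also have "\<dots> = (\<Sum>i = 1..<k. \<Sum>n = i * k ^ N..<Suc i * k ^ N. f n)"
    using k by (intro sum_consecutive_blocks) auto
  also have "\<dots> = (\<Sum>i = 1..<k. u \<bullet> (A i *v (mat_pow Mt N *v v)))"
  proof (intro sum.cong refl)
    fix i assume "i \<in> {1..<k}"
    then show "(\<Sum>n = i * k ^ N..<Suc i * k ^ N. f n) = u \<bullet> (A i *v (mat_pow Mt N *v v))"
      using cylinder_sum[of i "[]" 0 N] by (simp add: dot_lmul_matrix)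
  qed
  also have "\<dots> = u \<bullet> ((\<Sum>i = 1..<k. A i) *v (mat_pow Mt N *v v))"
    by (simp add: sum_mtx_vec inner_sum_right)
  also have "(\<Sum>i = 1..<k. A i) = (\<Sum>i<k. A i) - A 0"
    using k by (simp add: lessThan_atLeast0 sum.atLeast_Suc_lessThan[of 0 k])
  finally show ?thesis .
qed

lemma word_prod_replicate: "word_prod B (replicate m 0) = mat_pow B0 m" if "B0 = B 0"
  by (induction m) (simp_all add: mat_pow_Suc that)

lemma limit_vec_in_U:
  assumes "h \<in> phase_group Mt"
  shows "limit_vec k u A v h \<in> U"
proof -
  have "limit_vec k u A v h = mat_pow (At 0) 0 *v (num_prod k At 0 *v limit_vec k u A v h)"
    by (simp add: num_prod_def)
  then show ?thesis unfolding reduced_space_def using assms by (blast intro: span_base)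
qed

lemma base_digits_less: "set (base_digits k n) \<subseteq> {..<k}"
proof (induction n rule: less_induct)
  case (less n)
  then show ?case using k by (subst base_digits.simps) auto
qed

text \<open>This is what the powers of A_0 in the generators are for. Prefixing the digit 0 raises m
  by one; prefixing a nonzero digit i makes the m zeros interior digits of a new number.\<close>

lemma reduced_space_invariant:
  assumes "x \<in> U" "i < k"
  shows "At i *v x \<in> U"
  using assms(1) unfolding reduced_space_def
proof (rule span_induct)
  let ?G = "{mat_pow (At 0) m *v (num_prod k At n *v limit_vec k u A v h) |m n h. h \<in> phase_group Mt}"
  show "subspace {x. At i *v x \<in> span ?G}"
    by (auto intro!: subspaceI simp: matrix_vector_right_distrib matrix_vector_mult_scaleR
        span_add span_scale span_zero)
  fix x assume "x \<in> ?G"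
  then obtain m n h where x: "x = mat_pow (At 0) m *v (num_prod k At n *v limit_vec k u A v h)" and h: "h \<in> phase_group Mt"
    by blast
  show "At i *v x \<in> span ?G"
  proof (cases "i = 0")
    case True
    then have "At i *v x = mat_pow (At 0) (Suc m) *v (num_prod k At n *v limit_vec k u A v h)"
      by (simp add: x mat_pow_Suc matrix_vector_mul_assoc matrix_mul_assoc)
    then show ?thesis using h by (blast intro: span_base)
  next
    case False
    let ?w = "replicate m 0 @ base_digits k n"
    have "num_prod k At (digit_value k i ?w) = At i ** (mat_pow (At 0) m ** num_prod k At n)"
      using False assms(2) base_digits_less k
      by (subst num_prod_digit_value)
        (auto simp: num_prod_def base_digits_digit word_prod_append word_prod_replicate[OF refl])
    then have "At i *v x = mat_pow (At 0) 0 *v (num_prod k At (digit_value k i ?w) *v limit_vec k u A v h)"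
      by (simp add: x matrix_vector_mul_assoc matrix_mul_assoc)
    then show ?thesis using h by (blast intro: span_base)
  qed
qed

lemma word_prod_hat:
  assumes "x \<in> U" "set w \<subseteq> {..<k}"
  shows "word_prod At w *v x = word_prod Ah w *v x \<and> word_prod At w *v x \<in> U"
  using assms(2)
proof (induction w)
  case (Cons i w)
  then have IH: "word_prod At w *v x = word_prod Ah w *v x" "word_prod At w *v x \<in> U" and i: "i < k" by auto
  have "Ah i *v (word_prod At w *v x) = At i *v (word_prod At w *v x)"
    unfolding hat_def by (rule compress_invariant[OF subspace_U IH(2) reduced_space_invariant[OF IH(2) i]])
  then show ?case using reduced_space_invariant[OF IH(2) i] IH(1)
    by (simp add: matrix_vector_mul_assoc[symmetric])
qed (use assms(1) in simp)

text \<open>The reduced matrices sum to the compression of \<open>Mt\<close> to the subspace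
  \<open>U\<close>, which \<open>Mt\<close> leaves invariant.\<close>

lemma spec_rad_hat_le:
  assumes "spec_rad Mt > 0"
  shows "spec_rad (\<Sum>i<k. Ah i) \<le> spec_rad Mt"
proof -
  have Mt: "Mt = (\<Sum>i<k. At i)" by (simp add: tilde_sum_def tilde_def compress_sum)
  have "(\<Sum>i<k. Ah i) = compress U Mt" unfolding Mt by (simp add: hat_def compress_sum)
  moreover have "Mt *v x \<in> U" if "x \<in> U" for x
    unfolding Mt sum_mtx_vec using that by (intro subspace_sum[OF subspace_U] reduced_space_invariant) auto
  ultimately show ?thesis using assms by (simp add: spec_rad_compress_le[OF subspace_U])
qed

end

section \<open>The Lyapunov quantity\<close>

lemma powr_root_power:
  fixes P :: real
  assumes "0 \<le> P" "0 < j"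
  shows "(P powr (1 / real j)) ^ j = P"
proof (cases "P = 0")
  case False
  then show ?thesis using assms by (simp add: powr_powr flip: powr_realpow)
qed (use assms in simp)

text \<open>Fekete's lemma in multiplicative form, with roots in place of logarithms so that
  \<open>x n = 0\<close> is allowed. It gives the \<open>lim\<close> in \<open>lyapunov\<close> its
  meaning.\<close>

lemma submultiplicative_root_convergent:
  fixes x :: "nat \<Rightarrow> real"
  assumes nonneg: "\<And>n. 0 \<le> x n" and sub: "\<And>m n. x (m + n) \<le> x m * x n"
  shows "convergent (\<lambda>n. x n powr (1 / real n))"
proof -
  define y where "y = (\<lambda>n. x n powr (1 / real n))"
  define L where "L = (INF n\<in>{1..}. y n)"
  have bdd: "bdd_below (y ` {1..})" by (auto simp: y_def intro!: bdd_belowI[of _ 0])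
  have L0: "0 \<le> L" unfolding L_def by (rule cINF_greatest) (auto simp: y_def)
  have Ly: "L \<le> y n" if "1 \<le> n" for n unfolding L_def by (rule cINF_lower[OF bdd]) (use that in auto)
  have "y \<longlonglongrightarrow> L"
  proof (rule order_tendstoI)
    fix a assume "a < L"
    then show "\<forall>\<^sub>F n in sequentially. a < y n"
      by (intro eventually_mono[OF eventually_ge_at_top[of 1]]) (meson Ly less_le_trans)
  next
    fix a assume "L < a"
    then obtain q where q: "L < q" "q < a" using dense by blast
    then obtain n where n: "1 \<le> n" "y n < q"
      using cINF_less_iff[OF _ bdd, of q] unfolding L_def by auto
    have q0: "0 < q" using L0 q by simp
    have xn: "x n \<le> q ^ n"
    proof -
      have "x n = y n ^ n"
        using n nonneg[of n] by (simp add: y_def powr_root_power)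
      also have "\<dots> \<le> q ^ n" using n(2) by (intro power_mono) (auto simp: y_def)
      finally show ?thesis .
    qed
    have step: "x (c * n + b) \<le> q ^ (c * n) * x b" for c b
    proof (induction c)
      case (Suc c)
      have "x (Suc c * n + b) \<le> x n * x (c * n + b)" using sub[of n "c * n + b"] by (simp add: add_ac)
      also have "\<dots> \<le> q ^ n * (q ^ (c * n) * x b)"
        using Suc xn nonneg q0 by (intro mult_mono) auto
      finally show ?case by (simp add: power_add mult_ac)
    qed simp
    \<comment> \<open>D takes care of all remainders N mod n; the summand 1 makes it positive, so
      that its N-th roots tend to 1.\<close>
    define D where "D = 1 + (\<Sum>b<n. x b / q ^ b)"
    have D0: "0 < D" unfolding D_def using q0 nonneg by (intro add_pos_nonneg sum_nonneg) auto
    have xN: "x N \<le> D * q ^ N" for N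
    proof -
      have "x N \<le> q ^ (N div n * n) * x (N mod n)" using step[of "N div n" "N mod n"] by simp
      also have "\<dots> = q ^ N * (x (N mod n) / q ^ (N mod n))"
        using q0 by (simp add: power_add[symmetric] field_simps)
      also have "x (N mod n) / q ^ (N mod n) \<le> (\<Sum>b<n. x b / q ^ b)"
        using n(1) nonneg q0 by (intro member_le_sum) auto
      also have "q ^ N * (\<Sum>b<n. x b / q ^ b) \<le> q ^ N * D" using q0 by (simp add: D_def)
      finally show ?thesis using q0 by (simp add: mult.commute mult_left_mono)
    qed
    have "(\<lambda>N. D powr (1 / real N) * q) \<longlonglongrightarrow> D powr 0 * q"
      using D0 by (intro tendsto_mult tendsto_powr tendsto_const lim_const_over_n) auto
    then have "(\<lambda>N. D powr (1 / real N) * q) \<longlonglongrightarrow> q" using D0 by simp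
    then have "\<forall>\<^sub>F N in sequentially. D powr (1 / real N) * q < a" using q(2) by (rule order_tendstoD)
    then show "\<forall>\<^sub>F N in sequentially. y N < a"
      using eventually_ge_at_top[of 1]
    proof eventually_elim
      case (elim N)
      have "y N \<le> (D * q ^ N) powr (1 / real N)"
        unfolding y_def using xN nonneg by (intro powr_mono2) auto
      also have "\<dots> = D powr (1 / real N) * q"
        using D0 q0 elim(2) by (simp add: powr_mult powr_powr flip: powr_realpow)
      finally show ?case using elim(1) by simp
    qed
  qed
  then show ?thesis by (auto simp: y_def convergent_def)
qed

abbreviation word_norm :: "(nat \<Rightarrow> real ^ 'd ^ 'd) \<Rightarrow> nat list \<Rightarrow> real" where
  "word_norm B w \<equiv> onorm ((*v) (word_prod B w))"

lemma word_norm_nonneg [simp]: "0 \<le> word_norm B w"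
  by (intro onorm_pos_le) (rule matrix_vector_mul_bounded_linear)

lemma word_norm_append: "word_norm B (w @ w') \<le> word_norm B w * word_norm B w'"
proof -
  have "(*v) (word_prod B (w @ w')) = (*v) (word_prod B w) \<circ> (*v) (word_prod B w')"
    by (auto simp: word_prod_append matrix_vector_mul_assoc)
  then show ?thesis
    using onorm_compose[OF matrix_vector_mul_bounded_linear matrix_vector_mul_bounded_linear,
        of "word_prod B w" "word_prod B w'"] by simp
qed

lemma card_words: "card (words k n) = k ^ n"
  using card_lists_length_eq[of "{..<k}" n] by (simp add: words_def)

lemma bij_words_append:
  "bij_betw (\<lambda>(w, w'). w @ w') (words k m \<times> words k n) (words k (m + n))"
proof (rule bij_betwI[where g = "\<lambda>w. (take m w, drop m w)"])
  show "(\<lambda>w. (take m w, drop m w)) \<in> words k (m + n) \<rightarrow> words k m \<times> words k n"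
    by (auto simp: words_def dest: in_set_takeD in_set_dropD)
qed (auto simp: words_def)

lemma power_powr_root:
  fixes P :: real
  assumes "0 \<le> P" "0 < i" "0 < j"
  shows "(P ^ j) powr (1 / real (i * j)) = P powr (1 / real i)"
proof (cases "P = 0")
  case False
  then show ?thesis using assms by (simp add: powr_powr flip: powr_realpow)
qed (use assms in simp)

text \<open>A word of length m is a prefix of k^n words of length m + n, so its norm occurs to the
  power k^n; the root of order k^(m+n) turns this into the root of order k^m. Suffixes behave in the
  same way.\<close>

lemma geometric_mean_submultiplicative:
  fixes B :: "nat \<Rightarrow> real ^ 'd ^ 'd"
  assumes "0 < k"
  defines "X \<equiv> \<lambda>n. (\<Prod>w\<in>words k n. word_norm B w) powr (1 / real (k ^ n))"
  shows "X (m + n) \<le> X m * X n"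
proof -
  let ?P = "\<lambda>n. \<Prod>w\<in>words k n. word_norm B w"
  have P0: "0 \<le> ?P n" for n by (intro prod_nonneg) auto
  have "?P (m + n) = (\<Prod>(w, w')\<in>words k m \<times> words k n. word_norm B (w @ w'))"
    using prod.reindex_bij_betw[OF bij_words_append[where m = m and n = n and k = k], of "word_norm B"]
    by (simp add: case_prod_unfold)
  also have "\<dots> \<le> (\<Prod>(w, w')\<in>words k m \<times> words k n. word_norm B w * word_norm B w')"
    by (intro prod_mono) (auto simp: word_norm_append)
  also have "\<dots> = (\<Prod>w\<in>words k m. \<Prod>w'\<in>words k n. word_norm B w * word_norm B w')"
    by (simp only: prod.cartesian_product)
  also have "\<dots> = ?P m ^ (k ^ n) * ?P n ^ (k ^ m)"
    by (simp add: prod.distrib card_words prod_power_distrib)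
  finally have "X (m + n) \<le> (?P m ^ (k ^ n) * ?P n ^ (k ^ m)) powr (1 / real (k ^ (m + n)))"
    unfolding X_def using P0 by (intro powr_mono2) auto
  also have "\<dots> = (?P m ^ (k ^ n)) powr (1 / real (k ^ m * k ^ n)) * (?P n ^ (k ^ m)) powr (1 / real (k ^ n * k ^ m))"
    using P0 by (simp add: powr_mult power_add mult.commute)
  also have "\<dots> = X m * X n"
    using assms(1) P0 by (simp only: power_powr_root X_def zero_less_power)
  finally show ?thesis .
qed

text \<open>The limit lies strictly below q, so some length n does too. Clearing the roots states
  this for the plain product, which may be 0.\<close>

lemma lyapunov_witness:
  fixes B :: "nat \<Rightarrow> real ^ 'd ^ 'd"
  assumes k: "0 < k" and q: "lyapunov k B < q" "0 < q"
  shows "\<exists>n\<ge>1. (\<Prod>w\<in>words k n. word_norm B w) < (q ^ n) ^ (k ^ n)"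
proof -
  let ?P = "\<lambda>n. \<Prod>w\<in>words k n. word_norm B w"
  define X where "X = (\<lambda>n. ?P n powr (1 / real (k ^ n)))"
  have P0: "0 \<le> ?P n" for n by (intro prod_nonneg) auto
  have "convergent (\<lambda>n. X n powr (1 / real n))"
    unfolding X_def
    by (rule submultiplicative_root_convergent[OF _ geometric_mean_submultiplicative[OF k]]) simp
  moreover have "(\<Prod>w\<in>words k n. word_norm B w powr (1 / real n)) powr (1 / real (k ^ n)) = X n powr (1 / real n)" for n
  proof -
    have "(\<Prod>w\<in>words k n. word_norm B w powr (1 / real n)) = ?P n powr (1 / real n)"
      by (simp add: prod_powr_distrib)
    then show ?thesis by (simp add: X_def powr_powr mult.commute)
  qed
  then have "lyapunov k B = lim (\<lambda>n. X n powr (1 / real n))"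
    by (simp add: lyapunov_def words_def)
  ultimately have "(\<lambda>n. X n powr (1 / real n)) \<longlonglongrightarrow> lyapunov k B"
    by (simp add: convergent_LIMSEQ_iff)
  then have "\<forall>\<^sub>F n in sequentially. X n powr (1 / real n) < q" using q(1) by (rule order_tendstoD)
  then obtain n where n: "1 \<le> n" "X n powr (1 / real n) < q"
    by (metis (no_types, lifting) eventually_sequentially nat_le_linear)
  have "?P n = X n ^ (k ^ n)"
    unfolding X_def using P0[of n] k by (intro powr_root_power[symmetric]) auto
  also have "X n = (X n powr (1 / real n)) ^ n"
    using n(1) by (intro powr_root_power[symmetric]) (auto simp: X_def)
  also have "((X n powr (1 / real n)) ^ n) ^ (k ^ n) < (q ^ n) ^ (k ^ n)"
    using n k by (intro power_strict_mono) auto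
  finally show ?thesis using n(1) by blast
qed

text \<open>After division by c the moment at exponent 0 is \<open>card W\<close>, and a negative
  slope there pushes it below that value for small positive exponents.\<close>

lemma small_moment_below_geometric_mean:
  fixes a :: "'a \<Rightarrow> real"
  assumes fin: "finite W" and a: "\<And>w. w \<in> W \<Longrightarrow> 0 \<le> a w" and c: "0 < c"
    and less: "(\<Prod>w\<in>W. a w) < c ^ card W"
  shows "\<exists>s. 0 < s \<and> s < 1 \<and> (\<Sum>w\<in>W. a w powr s) < card W * c powr s"
proof -
  txt \<open>Some a w may vanish; raising them to a small e > 0 makes the logarithms finite.\<close>
  have "((\<lambda>e. \<Prod>w\<in>W. max (a w) e) \<longlongrightarrow> (\<Prod>w\<in>W. max (a w) 0)) (at_right 0)"
    by (intro tendsto_prod tendsto_max tendsto_const tendsto_ident_at)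
  moreover have "(\<Prod>w\<in>W. max (a w) 0) = (\<Prod>w\<in>W. a w)" using a by (intro prod.cong) auto
  ultimately have "((\<lambda>e. \<Prod>w\<in>W. max (a w) e) \<longlongrightarrow> (\<Prod>w\<in>W. a w)) (at_right 0)"
    by simp
  then have "\<forall>\<^sub>F e in at_right 0. (\<Prod>w\<in>W. max (a w) e) < c ^ card W" using less by (rule order_tendstoD)
  then have "\<forall>\<^sub>F e in at_right 0. 0 < e \<and> (\<Prod>w\<in>W. max (a w) e) < c ^ card W"
    using eventually_at_right_less[of 0] by eventually_elim simp
  from eventually_happens'[OF trivial_limit_at_right_real this]
  obtain e where e: "0 < e" "(\<Prod>w\<in>W. max (a w) e) < c ^ card W" by blast
  define b where "b = (\<lambda>w. max (a w) e / c)"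
  have b: "0 < b w" for w using e(1) c by (simp add: b_def)
  have "(\<Prod>w\<in>W. b w) < 1" using e(2) c by (simp add: b_def prod_dividef)
  moreover have "0 < (\<Prod>w\<in>W. b w)" using b by (intro prod_pos) auto
  ultimately have "ln (\<Prod>w\<in>W. b w) < 0" by simp
  then have neg: "(\<Sum>w\<in>W. ln (b w)) < 0" using b less_imp_neq[OF b] by (subst (asm) ln_prod[OF fin]) (auto simp: less_imp_neq[OF b, symmetric])
  txt \<open>The slope of the moment at the exponent 0 is the logarithm of the product.\<close>
  have "((\<lambda>s. \<Sum>w\<in>W. b w powr s) has_real_derivative (\<Sum>w\<in>W. ln (b w))) (at 0)"
  proof (rule DERIV_sum)
    fix w
    show "((\<lambda>s. b w powr s) has_real_derivative ln (b w)) (at 0)"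
      using b[of w] by (auto intro!: derivative_eq_intros simp: powr_def)
  qed
  from DERIV_neg_dec_right[OF this neg] obtain d where
    d: "0 < d" "\<And>h. 0 < h \<Longrightarrow> h < d \<Longrightarrow> (\<Sum>w\<in>W. b w powr h) < (\<Sum>w\<in>W. b w powr 0)"
    by auto
  \<comment> \<open>Staying below 1 as well leaves a positive weight 1 - s for the lengths of the
    cells.\<close>
  define s where "s = min (d / 2) (1 / 2)"
  have s: "0 < s" "s < 1" "s < d" using d(1) by (auto simp: s_def)
  have "(\<Sum>w\<in>W. a w powr s) \<le> (\<Sum>w\<in>W. b w powr s * c powr s)"
  proof (rule sum_mono)
    fix w assume w: "w \<in> W"
    have "a w powr s \<le> (b w * c) powr s" using a[OF w] c s(1) by (intro powr_mono2) (auto simp: b_def)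
    then show "a w powr s \<le> b w powr s * c powr s" using b[of w] c by (simp add: powr_mult)
  qed
  also have "\<dots> = (\<Sum>w\<in>W. b w powr s) * c powr s" by (simp add: sum_distrib_right)
  also have "\<dots> < (\<Sum>w\<in>W. b w powr 0) * c powr s"
    using d(2)[of s] s c by (intro mult_strict_right_mono) auto
  \<comment> \<open>Positivity of b matters here, since \<open>0 powr 0\<close> is 0.\<close>
  also have "(\<Sum>w\<in>W. b w powr 0) = card W" using b by (simp add: less_imp_neq[symmetric])
  finally show ?thesis using s by blast
qed

text \<open>The power s preserves submultiplicativity, and the sum over all concatenations of two
  words factors.\<close>

lemma sum_word_norm_powr_le:
  fixes B :: "nat \<Rightarrow> real ^ 'd ^ 'd"
  assumes s: "0 < s"
  shows "(\<Sum>w\<in>words k (n * m). word_norm B w powr s) \<le> (\<Sum>w\<in>words k n. word_norm B w powr s) ^ m"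
proof (induction m)
  case 0
  have "onorm ((*v) (mat 1 :: real ^ 'd ^ 'd)) \<le> 1" by (rule onorm_bound) auto
  then show ?case using powr_mono2[of s "onorm ((*v) (mat 1 :: real ^ 'd ^ 'd))" 1] s word_norm_nonneg[of B "[]"]
    by (simp del: matrix_vector_mul_lid)
next
  case (Suc m)
  let ?F = "\<lambda>w. word_norm B w powr s"
  have "(\<Sum>w\<in>words k (n * Suc m). ?F w) = (\<Sum>(w, w')\<in>words k n \<times> words k (n * m). ?F (w @ w'))"
    using sum.reindex_bij_betw[OF bij_words_append[where m = n and n = "n * m" and k = k], of ?F]
    by (simp add: case_prod_unfold)
  also have "\<dots> \<le> (\<Sum>(w, w')\<in>words k n \<times> words k (n * m). ?F w * ?F w')"
  proof (rule sum_mono, clarify)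
    fix w w'
    have "?F (w @ w') \<le> (word_norm B w * word_norm B w') powr s"
      using s by (intro powr_mono2 word_norm_append) auto
    then show "?F (w @ w') \<le> ?F w * ?F w'" by (simp add: powr_mult)
  qed
  also have "\<dots> = (\<Sum>w\<in>words k n. ?F w) * (\<Sum>w\<in>words k (n * m). ?F w)"
    by (simp add: sum.cartesian_product sum_product)
  also have "\<dots> \<le> (\<Sum>w\<in>words k n. ?F w) * (\<Sum>w\<in>words k n. ?F w) ^ m"
    using Suc by (intro mult_left_mono sum_nonneg) auto
  finally show ?case by simp
qed

text \<open>\<theta> is the ratio of the two sides of the moment inequality at length n. The factor
  next to \<theta>^m is the moment that results if every word of length n m has norm q^(n
  m).\<close>

lemma lyapunov_moment_decay:
  fixes B :: "nat \<Rightarrow> real ^ 'd ^ 'd"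
  assumes k: "0 < k" and q: "lyapunov k B < q" "0 < q"
  shows "\<exists>n s \<theta>. 1 \<le> n \<and> 0 < s \<and> s < 1 \<and> 0 \<le> \<theta> \<and> \<theta> < 1 \<and>
    (\<forall>m. (\<Sum>w\<in>words k (n * m). word_norm B w powr s) \<le> \<theta> ^ m * (real k ^ (n * m) * (q ^ (n * m)) powr s))"
proof -
  obtain n where n: "1 \<le> n" "(\<Prod>w\<in>words k n. word_norm B w) < (q ^ n) ^ (k ^ n)"
    using lyapunov_witness[OF k q] by blast
  then obtain s where s: "0 < s" "s < 1"
    and less: "(\<Sum>w\<in>words k n. word_norm B w powr s) < real (k ^ n) * (q ^ n) powr s"
    using small_moment_below_geometric_mean[of "words k n" "word_norm B" "q ^ n"] q(2) by (auto simp: card_words)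
  let ?S = "\<Sum>w\<in>words k n. word_norm B w powr s" and ?K = "real (k ^ n) * (q ^ n) powr s"
  have K: "0 < ?K" using k q(2) by simp
  have "(\<Sum>w\<in>words k (n * m). word_norm B w powr s) \<le> (?S / ?K) ^ m * (real k ^ (n * m) * (q ^ (n * m)) powr s)" for m
  proof -
    have "(real (k ^ n)) ^ m = real k ^ (n * m)" by (simp add: power_mult)
    moreover have "((q ^ n) powr s) ^ m = (q ^ (n * m)) powr s"
      using q(2) by (simp add: powr_powr mult_ac flip: powr_realpow)
    ultimately have "?K ^ m = real k ^ (n * m) * (q ^ (n * m)) powr s" by (simp only: power_mult_distrib)
    moreover have "?S ^ m = (?S / ?K) ^ m * ?K ^ m"
      unfolding power_mult_distrib[symmetric] using less_imp_neq[OF K] by (metis nonzero_eq_divide_eq)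
    ultimately have "?S ^ m = (?S / ?K) ^ m * (real k ^ (n * m) * (q ^ (n * m)) powr s)" by (simp only:)
    then show ?thesis using sum_word_norm_powr_le[OF s(1), of B k n m] by simp
  qed
  moreover have "0 \<le> ?S / ?K" "?S / ?K < 1" using less K by (auto intro!: divide_nonneg_pos sum_nonneg)
  ultimately show ?thesis using n(1) s by blast
qed

section \<open>Measures on the circle\<close>

text \<open>Half-open arcs tile the circle. The levels of the proof take K = k^p (k - 1), the number
  of integers with p + 1 digits.\<close>

definition cell :: "nat \<Rightarrow> nat \<Rightarrow> real set" where
  "cell K b = {real b / real K..<(real b + 1) / real K}"

lemma cell_subset: "b < K \<Longrightarrow> cell K b \<subseteq> {0..<1}"
proof -
  assume b: "b < K"
  then have "(real b + 1) / real K \<le> 1" by (simp add: divide_le_eq_1)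
  moreover have "0 \<le> real b / real K" by simp
  ultimately show ?thesis unfolding cell_def by (intro subsetI) (simp only: atLeastLessThan_iff, linarith)
qed

lemma cells_cover:
  assumes "0 < K" "x \<in> {0..<1}"
  shows "\<exists>b<K. x \<in> cell K b"
proof -
  define b where "b = nat \<lfloor>x * real K\<rfloor>"
  have x0: "0 \<le> x * real K" using assms by simp
  have b: "real b \<le> x * real K" "x * real K < real b + 1"
    using x0 by (auto simp: b_def)
  have "x * real K < 1 * real K" using assms by (intro mult_strict_right_mono) auto
  then have "real b < real K" using b(1) by simp
  then show ?thesis using b assms(1) by (auto simp: cell_def field_simps)
qed

text \<open>On the cells of \<open>G m\<close> the minimum is the \<mu>-mass, on the others it is
  the length. Hence the same sum bounds both the \<mu>-mass of \<open>A m\<close> and the length of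
  its complement.\<close>

lemma singular_by_overlap:
  fixes \<mu> :: "real measure" and K :: "nat \<Rightarrow> nat"
  assumes sets_mu: "sets \<mu> = sets circle_borel" and "prob_space \<mu>"
    and K: "\<And>m. 0 < K m"
    and overlap: "\<And>m. (\<Sum>b<K m. min (measure \<mu> (cell (K m) b)) (1 / real (K m))) \<le> \<epsilon> m"
    and summable: "summable \<epsilon>"
  shows "singular_measures \<mu> circle_lebesgue"
proof -
  interpret prob_space \<mu> by fact
  let ?L = "circle_lebesgue"
  have sets_L: "sets ?L = sets \<mu>" by (simp add: sets_mu sets_restrict_space)
  have space_L: "space ?L = {0..<1}" and space_mu: "space \<mu> = {0..<1}"
    using sets_eq_imp_space_eq[OF sets_mu] by (simp_all add: space_restrict_space)
  have meas: "X \<in> sets \<mu>" if "X \<in> sets borel" "X \<subseteq> {0..<1}" for X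
    using that by (auto simp: sets_mu sets_restrict_space)
  have cell_sets: "cell (K m) b \<in> sets \<mu>" if "b < K m" for m b
    using cell_subset[OF that] by (intro meas) (auto simp: cell_def)
  have em_L: "emeasure ?L X = emeasure lborel X" if "X \<in> sets borel" "X \<subseteq> {0..<1}" for X
    using that by (simp add: emeasure_restrict_space)
  interpret L: finite_measure ?L
    by (rule finite_measureI) (simp add: space_L em_L)
  have L_cell: "measure ?L (cell (K m) b) = 1 / real (K m)" if "b < K m" for m b
  proof -
    have "emeasure ?L (cell (K m) b) = ennreal ((real b + 1) / real (K m) - real b / real (K m))"
      using cell_subset[OF that] K[of m] by (subst em_L) (auto simp: cell_def divide_right_mono)
    then show ?thesis by (simp add: measure_def diff_divide_distrib[symmetric])
  qed
  have \<epsilon>0: "0 \<le> \<epsilon> m" for m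
    using overlap[of m] by (intro order_trans[OF sum_nonneg overlap]) auto
  define G where "G = (\<lambda>m. {b. b < K m \<and> measure \<mu> (cell (K m) b) \<le> 1 / real (K m)})"
  define A where "A = (\<lambda>m. \<Union>b\<in>G m. cell (K m) b)"
  have G: "G m \<subseteq> {..<K m}" "finite (G m)" for m by (auto simp: G_def)
  have A_sets: "A m \<in> sets \<mu>" for m
    unfolding A_def by (intro sets.finite_UN cell_sets) (auto simp: G_def)
  have A_mu: "measure \<mu> (A m) \<le> \<epsilon> m" for m
  proof -
    have "measure \<mu> (A m) \<le> (\<Sum>b\<in>G m. measure \<mu> (cell (K m) b))"
      unfolding A_def using cell_sets by (intro finite_measure_subadditive_finite) (auto simp: G_def)
    also have "\<dots> = (\<Sum>b\<in>G m. min (measure \<mu> (cell (K m) b)) (1 / real (K m)))"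
      by (intro sum.cong) (auto simp: G_def)
    also have "\<dots> \<le> (\<Sum>b<K m. min (measure \<mu> (cell (K m) b)) (1 / real (K m)))"
      using G by (intro sum_mono2) auto
    finally show ?thesis using overlap[of m] by simp
  qed
  have A_L: "measure ?L ({0..<1} - A m) \<le> \<epsilon> m" for m
  proof -
    have "{0..<1} - A m \<subseteq> (\<Union>b\<in>{..<K m} - G m. cell (K m) b)"
      using cells_cover[OF K[of m]] by (force simp: A_def)
    then have "measure ?L ({0..<1} - A m) \<le> measure ?L (\<Union>b\<in>{..<K m} - G m. cell (K m) b)"
      using cell_sets by (intro L.finite_measure_mono) (auto simp: sets_L)
    also have "\<dots> \<le> (\<Sum>b\<in>{..<K m} - G m. measure ?L (cell (K m) b))"
      using cell_sets by (intro L.finite_measure_subadditive_finite) (auto simp: sets_L)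
    also have "\<dots> = (\<Sum>b\<in>{..<K m} - G m. min (measure \<mu> (cell (K m) b)) (1 / real (K m)))"
      by (intro sum.cong) (auto simp: G_def L_cell)
    also have "\<dots> \<le> (\<Sum>b<K m. min (measure \<mu> (cell (K m) b)) (1 / real (K m)))"
      by (intro sum_mono2) auto
    finally show ?thesis using overlap[of m] by simp
  qed
  have "limsup A \<in> null_sets \<mu>"
    using A_mu by (intro borel_cantelli_limsup1 A_sets summable_comparison_test'[OF summable])
      (auto simp: emeasure_eq_measure)
  moreover have "limsup (\<lambda>m. {0..<1} - A m) \<in> null_sets ?L"
  proof (intro borel_cantelli_limsup1 summable_comparison_test'[OF summable])
    show "{0..<1} - A m \<in> sets ?L" for m
      using sets.compl_sets[OF A_sets[of m]] by (simp add: sets_L space_mu)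
  qed (use A_L in \<open>auto simp: L.emeasure_eq_measure\<close>)
  \<comment> \<open>A point outside the limit superior lies in all but finitely many of the
    complements, in particular in infinitely many.\<close>
  moreover have "space ?L - limsup A \<subseteq> limsup (\<lambda>m. {0..<1} - A m)"
  proof
    fix x assume x: "x \<in> space ?L - limsup A"
    then obtain n where "x \<notin> (\<Union>m\<in>{n..}. A m)" by (auto simp: limsup_INF_SUP)
    then have "x \<in> (\<Union>m\<in>{i..}. {0..<1} - A m)" for i
      using x by (intro UN_I[of "max i n"]) (auto simp: space_L)
    then show "x \<in> limsup (\<lambda>m. {0..<1} - A m)" by (auto simp: limsup_INF_SUP)
  qed
  moreover have "space ?L - limsup A \<in> sets ?L"
    using A_sets sets.compl_sets[of "limsup A" ?L] by (simp add: sets_L)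
  ultimately have "limsup A \<in> null_sets \<mu>" "space ?L - limsup A \<in> null_sets ?L"
    using null_sets_subset by blast+
  then have "limsup A \<in> sets \<mu>" "emeasure \<mu> (limsup A) = 0" "emeasure ?L (space ?L - limsup A) = 0"
    by auto
  then show ?thesis unfolding singular_measures_def using sets_L by metis
qed

text \<open>The bound 1 - \<delta> on the distance excludes the neighbouring humps of the cosine,
  which are centred at \<gamma> - 1 and \<gamma> + 1.\<close>

lemma cos_above_iff:
  fixes x \<gamma> \<delta> :: real
  assumes "0 \<le> \<delta>" "\<delta> \<le> 1 / 2" "\<bar>x - \<gamma>\<bar> \<le> 1 - \<delta>"
  shows "cos (2 * pi * (x - \<gamma>)) > cos (2 * pi * \<delta>) \<longleftrightarrow> \<bar>x - \<gamma>\<bar> < \<delta>"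
proof -
  define t where "t = \<bar>x - \<gamma>\<bar>"
  have c: "cos (2 * pi * (x - \<gamma>)) = cos (2 * pi * t)"
    using cos_abs_real[of "2 * pi * (x - \<gamma>)"] by (simp add: t_def abs_mult)
  have pi2: "2 * pi * y \<le> pi" if "y \<le> 1 / 2" for y :: real
    using that mult_left_mono[of y "1 / 2" "2 * pi"] by simp
  show ?thesis
  proof (cases "t < \<delta>")
    case True
    then have "cos (2 * pi * \<delta>) < cos (2 * pi * t)"
      using assms pi2[of \<delta>] by (intro cos_monotone_0_pi) (auto simp: t_def)
    then show ?thesis using True c by (simp add: t_def)
  next
    case False
    have "cos (2 * pi * t) \<le> cos (2 * pi * \<delta>)"
    proof (cases "t \<le> 1 / 2")
      case True
      then show ?thesis using False assms pi2[of t] by (intro cos_monotone_0_pi_le) auto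
    next
      case big: False
      have "cos (2 * pi * t) = cos (2 * pi * (1 - t))"
        by (metis cos_2pi_minus mult.right_neutral right_diff_distrib)
      also have "\<dots> \<le> cos (2 * pi * \<delta>)"
        using False big assms pi2[of "1 - t"] by (intro cos_monotone_0_pi_le) (auto simp: t_def)
      finally show ?thesis .
    qed
    then show ?thesis using False c by (simp add: t_def)
  qed
qed

text \<open>The portmanteau inequality for open arcs: the indicator is a pointwise limit of
  continuous periodic functions below it, and dominated convergence carries their bound over to the
  arc.\<close>

lemma weak_limit_open_interval:
  fixes \<mu> :: "real measure" and M :: "nat \<Rightarrow> real measure"
  assumes conv: "circle_weak_conv M \<mu>" and sets_mu: "sets \<mu> = sets circle_borel" and "prob_space \<mu>"
    and ab: "0 \<le> \<alpha>" "\<alpha> < \<beta>" "\<beta> \<le> 1" and g: "g \<longlonglongrightarrow> c"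
    and bound: "\<And>\<phi>. continuous_on UNIV \<phi> \<Longrightarrow>
       (\<And>x. x \<in> {0..<1} \<Longrightarrow> 0 \<le> \<phi> x \<and> \<phi> x \<le> indicator {\<alpha><..<\<beta>} x) \<Longrightarrow>
       \<forall>\<^sub>F j in sequentially. integral\<^sup>L (M j) \<phi> \<le> g j"
  shows "measure \<mu> {\<alpha><..<\<beta>} \<le> c"
proof -
  interpret prob_space \<mu> by fact
  have space_mu: "space \<mu> = {0..<1}"
    using sets_eq_imp_space_eq[OF sets_mu] by (simp add: space_restrict_space)
  define \<gamma> where "\<gamma> = (\<alpha> + \<beta>) / 2"
  define \<delta> where "\<delta> = (\<beta> - \<alpha>) / 2"
  define d where "d = (\<lambda>x. cos (2 * pi * (x - \<gamma>)) - cos (2 * pi * \<delta>))"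
  txt \<open>Bumps cut out of a shifted cosine are 1-periodic without any gluing.\<close>
  define \<phi> where "\<phi> = (\<lambda>n x. max 0 (min 1 (real n * d x)))"
  have d_pos: "0 < d x \<longleftrightarrow> x \<in> {\<alpha><..<\<beta>}" if "x \<in> {0..<1}" for x
  proof -
    have "0 < d x \<longleftrightarrow> \<bar>x - \<gamma>\<bar> < \<delta>"
      unfolding d_def using cos_above_iff[of \<delta> x \<gamma>] ab that by (auto simp: \<gamma>_def \<delta>_def abs_if field_simps)
    then show ?thesis by (auto simp: \<gamma>_def \<delta>_def abs_if field_simps split: if_splits)
  qed
  have cont: "continuous_on UNIV (\<phi> n)" for n
    unfolding \<phi>_def d_def by (intro continuous_intros)
  have per: "\<phi> n (x + 1) = \<phi> n x" for n x
  proof -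
    have "2 * pi * (x + 1 - \<gamma>) = 2 * pi * (x - \<gamma>) + 2 * pi" by (simp add: algebra_simps)
    then have "cos (2 * pi * (x + 1 - \<gamma>)) = cos (2 * pi * (x - \<gamma>))" by (metis cos_periodic)
    then show ?thesis by (simp add: \<phi>_def d_def)
  qed
  have le: "0 \<le> \<phi> n x \<and> \<phi> n x \<le> indicator {\<alpha><..<\<beta>} x" if "x \<in> {0..<1}" for n x
  proof (cases "x \<in> {\<alpha><..<\<beta>}")
    case False
    then have "d x \<le> 0" using d_pos[OF that] by linarith
    then have "real n * d x \<le> 0" by (simp add: mult_nonneg_nonpos)
    then show ?thesis by (simp add: \<phi>_def)
  qed (simp add: \<phi>_def)
  have int_le: "integral\<^sup>L \<mu> (\<phi> n) \<le> c" for n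
  proof (rule tendsto_le[OF _ g])
    show "(\<lambda>j. integral\<^sup>L (M j) (\<phi> n)) \<longlonglongrightarrow> integral\<^sup>L \<mu> (\<phi> n)"
      using conv cont per unfolding circle_weak_conv_def by blast
  qed (use bound[OF cont le] in auto)
  have meas_phi: "\<phi> n \<in> borel_measurable \<mu>" for n
    unfolding measurable_cong_sets[OF sets_mu refl]
    by (intro measurable_restrict_space1 borel_measurable_continuous_onI cont)
  have I_sets: "{\<alpha><..<\<beta>} \<in> sets \<mu>"
    using ab by (auto simp: sets_mu sets_restrict_space image_iff intro!: bexI[of _ "{\<alpha><..<\<beta>}"])
  have "(\<lambda>n. integral\<^sup>L \<mu> (\<phi> n)) \<longlonglongrightarrow> integral\<^sup>L \<mu> (indicator {\<alpha><..<\<beta>})"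
  proof (rule integral_dominated_convergence[where w = "\<lambda>_. 1"])
    show "AE x in \<mu>. (\<lambda>n. \<phi> n x) \<longlonglongrightarrow> indicator {\<alpha><..<\<beta>} x"
    proof (rule AE_I2)
      fix x assume "x \<in> space \<mu>"
      then have x: "x \<in> {0..<1}" by (simp add: space_mu)
      show "(\<lambda>n. \<phi> n x) \<longlonglongrightarrow> indicator {\<alpha><..<\<beta>} x"
      proof (cases "x \<in> {\<alpha><..<\<beta>}")
        case True
        then have dx: "0 < d x" using d_pos[OF x] by blast
        have "\<forall>\<^sub>F n in sequentially. \<phi> n x = 1"
          using eventually_ge_at_top[of "nat \<lceil>1 / d x\<rceil>"]
        proof eventually_elim
          case (elim n)
          then have "1 / d x \<le> real n" by linarith
          then have "1 \<le> real n * d x" using dx by (simp add: field_simps)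
          then show ?case by (simp add: \<phi>_def)
        qed
        then show ?thesis using True by (simp add: tendsto_eventually)
      next
        case False
        then have "\<phi> n x = 0" for n using le[OF x, of n] by simp
        then show ?thesis using False by simp
      qed
    qed
    show "AE x in \<mu>. norm (\<phi> n x) \<le> 1" for n
      by (auto simp: \<phi>_def)
  qed (use meas_phi I_sets in auto)
  then have "(\<lambda>n. integral\<^sup>L \<mu> (\<phi> n)) \<longlonglongrightarrow> measure \<mu> {\<alpha><..<\<beta>}"
    using I_sets sets.sets_into_space[OF I_sets] by (simp add: Int_absorb2)
  then show ?thesis by (rule LIMSEQ_le_const2) (use int_le in blast)
qed

lemma atom_position_in_circle:
  assumes "2 \<le> k" "m < k ^ (N + 1) - k ^ N"
  shows "real m / (real k ^ N * (real k - 1)) \<in> {0..<1}"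
proof -
  have "k ^ N \<le> k ^ (N + 1)" using assms(1) by simp
  then have "real (k ^ (N + 1) - k ^ N) = real k ^ (N + 1) - real k ^ N" by (simp only: of_nat_diff of_nat_power)
  then have "real (k ^ (N + 1) - k ^ N) = real k ^ N * (real k - 1)" by (simp add: algebra_simps)
  moreover have "real m < real (k ^ (N + 1) - k ^ N)" using assms(2) by (simp only: of_nat_less_iff)
  ultimately show ?thesis using assms(1) by (simp add: divide_less_eq_1_pos)
qed

lemma ghost_approx_integral:
  assumes k: "2 \<le> k" and f: "\<And>n. 0 \<le> f n" and \<phi>: "continuous_on UNIV (\<phi> :: real \<Rightarrow> real)"
  shows "integral\<^sup>L (ghost_approx k f N) \<phi> =
    (\<Sum>m<k ^ (N + 1) - k ^ N. f (k ^ N + m) / block_sum k f N * \<phi> (real m / (real k ^ N * (real k - 1))))"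
proof -
  let ?n = "k ^ (N + 1) - k ^ N"
  let ?P = "point_measure {0..<?n} (\<lambda>m. ennreal (f (k ^ N + m) / block_sum k f N))"
  let ?g = "\<lambda>m. real m / (real k ^ N * (real k - 1))"
  have "?g m \<in> {0..<1}" if "m < ?n" for m
    using atom_position_in_circle[OF k that] .
  then have g: "?g \<in> measurable ?P circle_borel"
    by (intro measurable_restrict_space2) (auto simp: space_point_measure)
  have "\<phi> \<in> borel_measurable circle_borel"
    by (intro measurable_restrict_space1 borel_measurable_continuous_onI \<phi>)
  then have "integral\<^sup>L (ghost_approx k f N) \<phi> = integral\<^sup>L ?P (\<lambda>m. \<phi> (?g m))"
    unfolding ghost_approx_def using g by (intro integral_distr) auto
  also have "\<dots> = (\<Sum>m\<in>{0..<?n}. f (k ^ N + m) / block_sum k f N * \<phi> (?g m))"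
    using f by (subst lebesgue_integral_point_measure_finite)
      (auto simp: block_sum_def intro!: divide_nonneg_nonneg sum_nonneg)
  finally show ?thesis by (simp add: lessThan_atLeast0)
qed

text \<open>An atom m lies in the open cell b when b k^q < m < (b + 1) k^q. Adding k^(p+q) turns
  these m into integers with prefix k^p + b; the left end of the block may be included because f is
  nonnegative.\<close>

lemma ghost_approx_cell_le:
  assumes k: "2 \<le> k" and f: "\<And>n. 0 \<le> f n" and \<phi>: "continuous_on UNIV \<phi>"
    and cell: "\<And>x. x \<in> {0..<1} \<Longrightarrow> 0 \<le> \<phi> x \<and> \<phi> x \<le> indicator {real b / K<..<(real b + 1) / K} x"
    and K: "K = real k ^ p * (real k - 1)" and b: "b < k ^ (p + 1) - k ^ p"
  shows "integral\<^sup>L (ghost_approx k f (p + q)) \<phi> \<le>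
    (\<Sum>n = (k ^ p + b) * k ^ q..<Suc (k ^ p + b) * k ^ q. f n) / block_sum k f (p + q)"
proof -
  let ?N = "p + q"
  let ?n = "k ^ (?N + 1) - k ^ ?N"
  let ?x = "\<lambda>m. real m / (real k ^ ?N * (real k - 1))"
  have bs: "0 \<le> block_sum k f ?N" using f by (simp add: block_sum_def sum_nonneg)
  have K0: "0 < K" using K k by simp
  have kq: "0 < real k ^ q" using k by simp
  have x: "?x m = real m / (real k ^ q * K)" for m by (simp add: K power_add mult_ac)
  have le: "\<phi> (?x m) \<le> (if m \<in> {b * k ^ q..<Suc b * k ^ q} then 1 else 0)" if "m < ?n" for m
  proof -
    have "?x m \<in> {0..<1}" using atom_position_in_circle[OF k that] .
    then have "\<phi> (?x m) \<le> indicator {real b / K<..<(real b + 1) / K} (?x m)" using cell by blast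
    also have "\<dots> \<le> (if m \<in> {b * k ^ q..<Suc b * k ^ q} then 1 else 0)"
    proof (cases "?x m \<in> {real b / K<..<(real b + 1) / K}")
      case True
      then have "real b * real k ^ q < real m" "real m < (real b + 1) * real k ^ q"
        unfolding x using K0 kq by (auto simp: field_simps)
      then have "real (b * k ^ q) < real m" "real m < real (Suc b * k ^ q)" by (auto simp: algebra_simps)
      then have "m \<in> {b * k ^ q..<Suc b * k ^ q}" unfolding of_nat_less_iff by simp
      then show ?thesis by simp
    qed simp
    finally show ?thesis .
  qed
  have "integral\<^sup>L (ghost_approx k f ?N) \<phi> \<le>
      (\<Sum>m<?n. f (k ^ ?N + m) / block_sum k f ?N * (if m \<in> {b * k ^ q..<Suc b * k ^ q} then 1 else 0))"
    unfolding ghost_approx_integral[OF k f \<phi>]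
    using bs f le by (intro sum_mono mult_left_mono) auto
  also have "\<dots> \<le> (\<Sum>m = b * k ^ q..<Suc b * k ^ q. f (k ^ ?N + m) / block_sum k f ?N)"
    using bs f by (auto simp: if_distrib[where f = "\<lambda>x. _ * x"] sum.If_cases cong: if_cong
        intro!: sum_mono2 divide_nonneg_nonneg)
  also have "\<dots> = (\<Sum>m = b * k ^ q..<Suc b * k ^ q. f (k ^ ?N + m)) / block_sum k f ?N"
    by (simp add: sum_divide_distrib)
  also have "(\<Sum>m = b * k ^ q..<Suc b * k ^ q. f (k ^ ?N + m)) =
      (\<Sum>n = b * k ^ q + k ^ ?N..<Suc b * k ^ q + k ^ ?N. f n)"
    by (simp only: sum.shift_bounds_nat_ivl add.commute[of "k ^ (p + q)"])
  finally show ?thesis by (simp add: power_add algebra_simps)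
qed

section \<open>Singularity of ghost measures\<close>

context representation
begin

text \<open>The mass is a limit of quotients of a cell sum by a block sum. Multiplying both by the
  growth coefficient makes each converge, and nondegeneracy at h keeps the limit of the denominator
  positive.\<close>

lemma ghost_measure_cell_bound:
  assumes f: "\<And>n. 0 \<le> f n" and nondeg: "nondegenerate_representation k u A v"
    and ghost: "ghost_measure k f \<mu>" and cont: "continuous_measure \<mu>"
  shows "\<exists>C\<ge>0. \<forall>p i w. 1 \<le> i \<longrightarrow> i < k \<longrightarrow> w \<in> words k p \<longrightarrow>
    measure \<mu> (cell (k ^ p * (k - 1)) (digit_value k i w - k ^ p)) \<le> C * (word_norm Ah w / spec_rad Mt ^ p)"
proof -
  let ?\<rho> = "spec_rad Mt" and ?gc = "growth_coeff Mt"
  have \<rho>: "0 < ?\<rho>" using nondeg by (simp add: nondegenerate_representation_def)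
  obtain S T J lam where "jordan_data Mt S T J lam" using ex_jordan_data by blast
  then interpret R: rotation_setting Mt S T J lam V
    using \<rho> subspace_V by unfold_locales (auto simp: tilde_sum_def compress_in compress_perp)
  from ghost obtain s where sets_mu: "sets \<mu> = sets circle_borel" and prob: "prob_space \<mu>" and s: "strict_mono s"
    and conv: "circle_weak_conv (\<lambda>j. ghost_approx k f (s j)) \<mu>"
    unfolding ghost_measure_def by blast
  interpret prob_space \<mu> by (rule prob)
  obtain r h where r: "strict_mono r" and h: "R.phase_limit (s \<circ> r) h"
    using R.phase_limit_subsequence[OF s] by blast
  define t where "t = s \<circ> r"
  have h: "R.phase_limit t h" using h by (simp add: t_def)
  have t: "filterlim t sequentially sequentially" using h by (simp add: R.phase_limit_def)
  \<comment> \<open>Thinning out the sequence keeps the weak limit, so one h serves the given ghost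
    measure.\<close>
  have conv: "circle_weak_conv (\<lambda>j. ghost_approx k f (t j)) \<mu>"
    unfolding circle_weak_conv_def
  proof (intro allI impI)
    fix \<phi> :: "real \<Rightarrow> real" assume "continuous_on UNIV \<phi> \<and> (\<forall>x. \<phi> (x + 1) = \<phi> x)"
    then have "(\<lambda>j. integral\<^sup>L (ghost_approx k f (s j)) \<phi>) \<longlonglongrightarrow> integral\<^sup>L \<mu> \<phi>"
      using conv unfolding circle_weak_conv_def by blast
    from LIMSEQ_subseq_LIMSEQ[OF this r]
    show "(\<lambda>j. integral\<^sup>L (ghost_approx k f (t j)) \<phi>) \<longlonglongrightarrow> integral\<^sup>L \<mu> \<phi>"
      by (simp add: t_def comp_def)
  qed
  \<comment> \<open>Cutting off p digits multiplies h by the power -p of the phases: the numerator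
    at level p has its own limit vector, while the denominator keeps that of h.\<close>
  define hp where "hp = (\<lambda>p l. h l * inverse (phase Mt l) ^ p)"
  have hp: "R.phase_limit (\<lambda>j. t j - p) (hp p)" for p
    unfolding hp_def by (rule R.phase_limit_shift[OF h])
  have lim: "(\<lambda>j. ?gc (t j) *\<^sub>R (mat_pow Mt (t j - p) *v v)) \<longlonglongrightarrow> (1 / ?\<rho> ^ p) *\<^sub>R limit_vec k u A v (hp p)" for p
    using R.shifted_power_tendsto[OF h, of p v] by (simp add: limit_vec_def hp_def)
  define D where "D = u \<bullet> (((\<Sum>i<k. A i) - A 0) *v limit_vec k u A v h)"
  have D: "0 < D"
    using nondeg R.phase_limit_in_group[OF h] by (simp add: D_def nondegenerate_representation_def)
  have den: "(\<lambda>j. ?gc (t j) * block_sum k f (t j)) \<longlonglongrightarrow> D"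
  proof -
    have "hp 0 = h" by (simp add: hp_def)
    then have "(\<lambda>j. ?gc (t j) *\<^sub>R (mat_pow Mt (t j) *v v)) \<longlonglongrightarrow> limit_vec k u A v h"
      using lim[of 0] by simp
    then have "(\<lambda>j. u \<bullet> (((\<Sum>i<k. A i) - A 0) *v (?gc (t j) *\<^sub>R (mat_pow Mt (t j) *v v)))) \<longlonglongrightarrow> D"
      unfolding D_def
      by (intro tendsto_inner tendsto_const bounded_linear.tendsto[OF matrix_vector_mul_bounded_linear])
    then show ?thesis by (simp add: block_sum_eq matrix_vector_mult_scaleR)
  qed
  obtain B where B: "0 \<le> B" "\<And>p. norm (limit_vec k u A v (hp p)) \<le> B"
    using R.limit_op_bounded[of v] hp unfolding limit_vec_def by blast
  \<comment> \<open>The sum serves every leading digit at once, and B every level p.\<close>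
  define C where "C = (\<Sum>i<k. norm (u v* A i)) * B / D"
  have C0: "0 \<le> C" unfolding C_def using B(1) D by (intro divide_nonneg_pos mult_nonneg_nonneg sum_nonneg) auto
  have main: "measure \<mu> (cell (k ^ p * (k - 1)) (digit_value k i w - k ^ p)) \<le> C * (word_norm Ah w / ?\<rho> ^ p)"
    if i: "1 \<le> i" "i < k" and w: "w \<in> words k p" for p i w
  proof -
    let ?a = "digit_value k i w"
    let ?x = "limit_vec k u A v (hp p)"
    let ?y = "u v* A i"
    \<comment> \<open>Integers with p + 1 digits start at k^p, so this counts the cells from
      0.\<close>
    define b where "b = ?a - k ^ p"
    define K where "K = k ^ p * (k - 1)"
    have realK: "real K = real k ^ p * (real k - 1)" using k by (simp add: K_def of_nat_diff)
    have K0: "0 < K" using k by (simp add: K_def)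
    have "1 * k ^ p \<le> i * k ^ p" using i by (intro mult_le_mono1)
    then have ab: "?a = k ^ p + b" using digit_value_bounds(1)[OF k w, of i] unfolding b_def by linarith
    have "?a < k * k ^ p"
      using digit_value_bounds(2)[OF k w, of i] mult_le_mono1[of "Suc i" k "k ^ p"] i(2) by linarith
    then have b: "b < k ^ (p + 1) - k ^ p" using ab by simp
    have bK: "b < K" using b k by (simp add: K_def algebra_simps)
    define F where "F = (\<lambda>j. \<Sum>n = ?a * k ^ (t j - p)..<Suc ?a * k ^ (t j - p). f n)"
    have "(\<lambda>j. ?y \<bullet> (word_prod At w *v (?gc (t j) *\<^sub>R (mat_pow Mt (t j - p) *v v))))
        \<longlonglongrightarrow> ?y \<bullet> (word_prod At w *v ((1 / ?\<rho> ^ p) *\<^sub>R ?x))"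
      by (intro tendsto_inner tendsto_const bounded_linear.tendsto[OF matrix_vector_mul_bounded_linear] lim)
    then have num: "(\<lambda>j. ?gc (t j) * F j) \<longlonglongrightarrow> ?y \<bullet> (word_prod At w *v ?x) / ?\<rho> ^ p"
      unfolding F_def cylinder_sum[OF i w] by (simp add: matrix_vector_mult_scaleR)
    define c where "c = ?y \<bullet> (word_prod At w *v ?x) / ?\<rho> ^ p / D"
    have "(\<lambda>j. (?gc (t j) * F j) / (?gc (t j) * block_sum k f (t j))) \<longlonglongrightarrow> c"
      unfolding c_def by (intro tendsto_divide num den) (use D in simp)
    moreover have "\<forall>\<^sub>F j in sequentially. (?gc (t j) * F j) / (?gc (t j) * block_sum k f (t j)) = F j / block_sum k f (t j)"
      using t[unfolded filterlim_at_top, rule_format, of 1]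
    proof eventually_elim
      case (elim j)
      then have "?gc (t j) \<noteq> 0" using R.growth_coeff_pos[of "t j"] by simp
      then show ?case by simp
    qed
    ultimately have g: "(\<lambda>j. F j / block_sum k f (t j)) \<longlonglongrightarrow> c" by (rule Lim_transform_eventually)
    let ?\<alpha> = "real b / real K" and ?\<beta> = "(real b + 1) / real K"
    have "measure \<mu> {?\<alpha><..<?\<beta>} \<le> c"
    proof (rule weak_limit_open_interval[OF conv sets_mu prob _ _ _ g])
      show "0 \<le> ?\<alpha>" by simp
      show "?\<alpha> < ?\<beta>" using K0 by (simp add: divide_strict_right_mono)
      show "?\<beta> \<le> 1" using bK by (simp add: divide_le_eq_1)
    next
      fix \<phi> :: "real \<Rightarrow> real"
      assume \<phi>: "continuous_on UNIV \<phi>" "\<And>x. x \<in> {0..<1} \<Longrightarrow> 0 \<le> \<phi> x \<and> \<phi> x \<le> indicator {?\<alpha><..<?\<beta>} x"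
      show "\<forall>\<^sub>F j in sequentially. integral\<^sup>L (ghost_approx k f (t j)) \<phi> \<le> F j / block_sum k f (t j)"
        using t[unfolded filterlim_at_top, rule_format, of p]
      proof eventually_elim
        case (elim j)
        then show ?case
          using ghost_approx_cell_le[OF k f \<phi> realK b, where q = "t j - p"] by (simp add: F_def ab)
      qed
    qed
    \<comment> \<open>The half-open cell exceeds the open arc by its left endpoint, which is not an
      atom.\<close>
    moreover have "measure \<mu> (cell K b) \<le> measure \<mu> {?\<alpha><..<?\<beta>}"
    proof -
      have cell_sets: "X \<in> sets \<mu>" if "X \<in> sets borel" "X \<subseteq> cell K b" for X
        using that cell_subset[OF bK] by (auto simp: sets_mu sets_restrict_space)
      have \<alpha>: "?\<alpha> \<in> cell K b" using K0 by (simp add: cell_def divide_strict_right_mono)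
      have "cell K b = {?\<alpha>} \<union> {?\<alpha><..<?\<beta>}" using \<alpha> by (auto simp: cell_def)
      then have "measure \<mu> (cell K b) = measure \<mu> ({?\<alpha>} \<union> {?\<alpha><..<?\<beta>})" by simp
      also have "\<dots> \<le> measure \<mu> {?\<alpha>} + measure \<mu> {?\<alpha><..<?\<beta>}"
        using \<alpha> by (intro measure_Un_le cell_sets) (auto simp: cell_def)
      also have "measure \<mu> {?\<alpha>} = 0"
      proof -
        have "{?\<alpha>} \<in> sets \<mu>" using \<alpha> by (intro cell_sets) auto
        then have "?\<alpha> \<in> space \<mu>" using sets.sets_into_space by blast
        then show ?thesis using cont by (simp add: continuous_measure_def measure_def)
      qed
      finally show ?thesis by simp
    qed
    moreover have "c \<le> C * (word_norm Ah w / ?\<rho> ^ p)"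
    proof -
      have x: "?x \<in> U" by (rule limit_vec_in_U[OF R.phase_limit_in_group[OF hp]])
      have "set w \<subseteq> {..<k}" using w by (simp add: words_def)
      then have "?y \<bullet> (word_prod At w *v ?x) = ?y \<bullet> (word_prod Ah w *v ?x)"
        using word_prod_hat[OF x] by simp
      also have "\<dots> \<le> norm ?y * norm (word_prod Ah w *v ?x)" by (rule norm_cauchy_schwarz)
      also have "\<dots> \<le> norm ?y * (word_norm Ah w * norm ?x)"
        by (intro mult_left_mono onorm matrix_vector_mul_bounded_linear) auto
      also have "\<dots> \<le> (\<Sum>i<k. norm (u v* A i)) * (word_norm Ah w * B)"
        using i B by (intro mult_mono member_le_sum mult_left_mono mult_nonneg_nonneg sum_nonneg) auto
      finally have "c \<le> (\<Sum>i<k. norm (u v* A i)) * (word_norm Ah w * B) / ?\<rho> ^ p / D"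
        unfolding c_def using D \<rho> by (intro divide_right_mono) auto
      then show ?thesis by (simp add: C_def field_simps)
    qed
    ultimately show ?thesis by (simp add: b_def K_def)
  qed
  then show ?thesis using C0 by blast
qed

lemma sum_cells:
  "(\<Sum>b<k ^ p * (k - 1). F b) = (\<Sum>i = 1..<k. \<Sum>w\<in>words k p. F (digit_value k i w - k ^ p))" for F :: "nat \<Rightarrow> real"
proof -
  have "(\<Sum>b<k ^ p * (k - 1). F b) = (\<Sum>n = 0 + k ^ p..<k ^ p * (k - 1) + k ^ p. F (n - k ^ p))"
    by (simp only: sum.shift_bounds_nat_ivl) (simp add: lessThan_atLeast0)
  also have "{0 + k ^ p..<k ^ p * (k - 1) + k ^ p} = {1 * k ^ p..<k * k ^ p}"
    using k by (cases k) (auto simp: algebra_simps)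
  also have "(\<Sum>n\<in>\<dots>. F (n - k ^ p)) = (\<Sum>i = 1..<k. \<Sum>n = i * k ^ p..<Suc i * k ^ p. F (n - k ^ p))"
    using k by (intro sum_consecutive_blocks) auto
  finally show ?thesis unfolding sum_digit_value .
qed

end

section \<open>Interpolation and summation over the cells\<close>

lemma min_le_powr:
  fixes x y :: real
  assumes "0 \<le> x" "0 \<le> y" "0 < s" "s < 1"
  shows "min x y \<le> x powr s * y powr (1 - s)"
proof (cases "x \<le> y")
  case True
  have "x = x powr s * x powr (1 - s)" using assms by (simp flip: powr_add)
  also have "\<dots> \<le> x powr s * y powr (1 - s)" using True assms by (intro mult_left_mono powr_mono2) auto
  finally show ?thesis using True by simp
next
  case False
  have "y = y powr s * y powr (1 - s)" using assms by (simp flip: powr_add)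
  also have "\<dots> \<le> x powr s * y powr (1 - s)" using False assms by (intro mult_right_mono powr_mono2) auto
  finally show ?thesis using False by simp
qed

theorem proposition3:
  fixes k :: nat
    and f :: "nat \<Rightarrow> real"
    and u v :: "real ^ 'd"
    and A :: "nat \<Rightarrow> real ^ 'd ^ 'd"
  assumes "k \<ge> 2"
    and "\<And>n. f n \<ge> 0"
    and "k_regular k f"
    and "minimal_representation k f u A v"
    and "nondegenerate_representation k u A v"
    and "lyapunov k (hat k u A v) < spec_rad (\<Sum>i<k. hat k u A v i) / real k"
  shows "\<forall>\<mu>. ghost_measure k f \<mu> \<and> continuous_measure \<mu> \<longrightarrow>
               singular_measures \<mu> circle_lebesgue"
proof (intro allI impI)
  fix \<mu> :: "real measure"
  assume \<mu>: "ghost_measure k f \<mu> \<and> continuous_measure \<mu>"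
  interpret representation k f u v A
    using assms(1,4) by unfold_locales (auto simp: minimal_representation_def)
  let ?\<rho> = "spec_rad Mt"
  have \<rho>: "0 < ?\<rho>" using assms(5) by (simp add: nondegenerate_representation_def)
  have k0: "0 < k" using assms(1) by simp
  \<comment> \<open>The cell bound decays with the spectral radius on \<open>V\<close>, so q is
    formed with it; the hypothesis carries over because the reduced sum has at most this spectral
    radius.\<close>
  define q where "q = ?\<rho> / real k"
  have q0: "0 < q" using \<rho> k0 by (simp add: q_def)
  have "spec_rad (\<Sum>i<k. Ah i) / real k \<le> q"
    unfolding q_def by (intro divide_right_mono spec_rad_hat_le \<rho>) simp
  then have "lyapunov k Ah < q" using assms(6) by linarith
  from lyapunov_moment_decay[OF k0 this q0] obtain n s \<theta> where s: "0 < s" "s < 1" and \<theta>: "0 \<le> \<theta>" "\<theta> < 1"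
    and decay: "\<And>m. (\<Sum>w\<in>words k (n * m). word_norm Ah w powr s) \<le> \<theta> ^ m * (real k ^ (n * m) * (q ^ (n * m)) powr s)"
    by blast
  obtain C where C: "0 \<le> C" "\<And>p i w. 1 \<le> i \<Longrightarrow> i < k \<Longrightarrow> w \<in> words k p \<Longrightarrow>
      measure \<mu> (cell (k ^ p * (k - 1)) (digit_value k i w - k ^ p)) \<le> C * (word_norm Ah w / ?\<rho> ^ p)"
    using ghost_measure_cell_bound[OF assms(2,5)] \<mu> by blast
  let ?K = "\<lambda>m. k ^ (n * m) * (k - 1)"
  show "singular_measures \<mu> circle_lebesgue"
  \<comment> \<open>The factor k - 1 counts the leading digits, C^s comes from the cell bound, and
    \<theta>^m from the moment at length n m.\<close>
  proof (rule singular_by_overlap[where K = ?K and \<epsilon> = "\<lambda>m. real (k - 1) * C powr s * \<theta> ^ m"])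
    show "0 < ?K m" for m using assms(1) by simp
    show "summable (\<lambda>m. real (k - 1) * C powr s * \<theta> ^ m)"
      using \<theta> by (intro summable_mult summable_geometric) simp
  next
    fix m
    define p where "p = n * m"
    let ?F = "\<lambda>b. min (measure \<mu> (cell (?K m) b)) (1 / real (?K m))"
    define W where "W = C powr s * (1 / (?\<rho> ^ p)) powr s * (1 / real k ^ p) powr (1 - s)"
    have le: "?F (digit_value k i w - k ^ p) \<le> W * word_norm Ah w powr s"
      if "i \<in> {1..<k}" "w \<in> words k p" for i w
    proof -
      have "?F (digit_value k i w - k ^ p) \<le> min (C * (word_norm Ah w / ?\<rho> ^ p)) (1 / real k ^ p)"
      proof (rule min.mono)
        show "measure \<mu> (cell (?K m) (digit_value k i w - k ^ p)) \<le> C * (word_norm Ah w / ?\<rho> ^ p)"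
          using C(2)[of i w p] that by (simp add: p_def)
        \<comment> \<open>Replacing the length of a cell by the larger 1 / k^p lets the powers of k
          cancel below.\<close>
        have "real k ^ p * 1 \<le> real k ^ p * real (k - 1)" using assms(1) by (intro mult_left_mono) auto
        then show "1 / real (?K m) \<le> 1 / real k ^ p"
          using k0 assms(1) by (intro divide_left_mono) (auto simp: p_def)
      qed
      also have "\<dots> \<le> (C * (word_norm Ah w / ?\<rho> ^ p)) powr s * (1 / real k ^ p) powr (1 - s)"
        using C(1) \<rho> s by (intro min_le_powr mult_nonneg_nonneg divide_nonneg_nonneg) auto
      also have "(C * (word_norm Ah w / ?\<rho> ^ p)) powr s = C powr s * (1 / (?\<rho> ^ p)) powr s * word_norm Ah w powr s"
        using C(1) \<rho> by (simp add: powr_mult powr_divide)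
      finally show ?thesis by (simp add: W_def mult_ac)
    qed
    have "(\<Sum>b<?K m. ?F b) = (\<Sum>i = 1..<k. \<Sum>w\<in>words k p. ?F (digit_value k i w - k ^ p))"
      using sum_cells[of ?F p] by (simp only: p_def)
    also have "\<dots> \<le> (\<Sum>i = 1..<k. \<Sum>w\<in>words k p. W * word_norm Ah w powr s)"
      by (intro sum_mono le)
    also have "\<dots> = real (k - 1) * (W * (\<Sum>w\<in>words k p. word_norm Ah w powr s))"
      by (simp add: sum_distrib_left)
    also have "\<dots> \<le> real (k - 1) * (W * (\<theta> ^ m * (real k ^ p * (q ^ p) powr s)))"
      using decay[of m] by (intro mult_left_mono) (auto simp: p_def W_def)
    \<comment> \<open>Everything that depends on p, apart from \<theta>^m, cancels: per digit the
      factors are \<rho>^s k^(-s) from q, then \<rho>^(-s), k^(-(1-s)) and k.\<close>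
    also have "W * (\<theta> ^ m * (real k ^ p * (q ^ p) powr s)) = C powr s * \<theta> ^ m"
    proof -
      have "(q ^ p) powr s * (1 / (?\<rho> ^ p)) powr s = (1 / real k ^ p) powr s"
        using \<rho> k0 by (simp add: q_def power_divide flip: powr_mult)
      moreover have "(1 / real k ^ p) powr s * (1 / real k ^ p) powr (1 - s) = 1 / real k ^ p"
        using k0 by (simp flip: powr_add)
      ultimately have "(q ^ p) powr s * (1 / (?\<rho> ^ p)) powr s * (1 / real k ^ p) powr (1 - s) * real k ^ p = 1"
        using k0 by simp
      moreover have "W * (\<theta> ^ m * (real k ^ p * (q ^ p) powr s)) = C powr s * \<theta> ^ m *
          ((q ^ p) powr s * (1 / (?\<rho> ^ p)) powr s * (1 / real k ^ p) powr (1 - s) * real k ^ p)"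
        by (simp only: W_def mult_ac)
      ultimately show ?thesis by simp
    qed
    finally show "(\<Sum>b<?K m. ?F b) \<le> real (k - 1) * C powr s * \<theta> ^ m" by simp
  qed (use \<mu> in \<open>auto simp: ghost_measure_def\<close>)
qed

end
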